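(* Let $G$ be a net-free co-chordal graph. Then $G$ is non-trivially minimally tough if and only if $G$ is isomorphic to one of the graphs $P_4$, $K_{2,3}$, $K_{1,\ell}$, $S_{k,\ell}$, $T_{2\ell,\ell}$, or $T_{2\ell-1,\ell}$, for some integers $k\geq 1$ and $\ell \geq 2$.
   Context: All graphs are finite, simple, and undirected. A graph is chordal if it has no induced cycle of length at least $4$; a graph $G$ is co-chordal if its complement $\overline{G}$ is chordal. The net is the graph obtained from the complete graph $K_3$ by attaching a pendant edge to each vertex; a graph is net-free if it has no induced subgraph isomorphic to the net. For a graph $H$, $c(H)$ denotes the number of connected components of $H$. A set $S\subseteq V(G)$ is a separator of $G$ if $c(G-S)\ge 2$. The toughness $\tau(G)$ of a graph $G$ is the minimum of $|S|/c(G-S)$ over all separators $S$ of $G$, with $\tau(G)=\infty$ if $G$ has no separators, that is, if $G$ is complete. (Disconnected graphs have toughness $0$.) For $t\in\mathbb{R}\cup\{\infty\}$, $G$ is minimally $t$-tough if $\tau(G)=t$ and $\tau(G-e)<t$ for every edge $e$ of $G$ ($G-e$ is obtained by deleting the edge $e$). $G$ is minimally tough if it is minimally $t$-tough for some $t\in\mathbb{R}\cup\{\infty\}$. Complete graphs and edgeless graphs are trivially minimally tough; all other minimally tough graphs are called non-trivially minimally tough. $P_4$ is the four-vertex path. $K_{m,n}$ is the complete bipartite graph with parts of sizes $m$ and $n$. $S_{a,b}$ (double star) is the graph obtained from the disjoint union of two stars $K_{1,a}$ and $K_{1,b}$ by adding an edge between their centers (the center of $K_{1,a}$ is its vertex of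 degree $a$; for $a=1$ an arbitrarily chosen vertex). $T_{n,k}$ denotes the complete multipartite graph with $n$ vertices and $k$ parts whose sizes are as equal as possible; thus all parts of $T_{2\ell,\ell}$ have size $2$, and all parts of $T_{2\ell-1,\ell}$ have size $2$ except one of size $1$. *)

theory Defs
  imports Complex_Main "HOL-Library.Extended_Real"
begin

text \<open>A graph is a pair of a vertex set and a set of edges, each edge being a two-element set of
  vertices. The null graph is not excluded.\<close>

type_synonym 'a ugraph = "'a set \<times> 'a set set"

abbreviation verts :: "'a ugraph \<Rightarrow> 'a set" where
  "verts \<equiv> fst"

abbreviation edges :: "'a ugraph \<Rightarrow> 'a set set" where
  "edges \<equiv> snd"

definition simple_graph :: "'a ugraph \<Rightarrow> bool" where
  "simple_graph G \<longleftrightarrow> finite (verts G) \<and> (\<forall>e\<in>edges G. e \<subseteq> verts G \<and> card e = 2)"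

definition graph_iso :: "'a ugraph \<Rightarrow> 'b ugraph \<Rightarrow> bool" (infix "\<simeq>\<^sub>g" 50) where
  "G \<simeq>\<^sub>g H \<longleftrightarrow> (\<exists>f. bij_betw f (verts G) (verts H) \<and>
     (\<forall>u\<in>verts G. \<forall>v\<in>verts G. {u, v} \<in> edges G \<longleftrightarrow> {f u, f v} \<in> edges H))"

definition complement :: "'a ugraph \<Rightarrow> 'a ugraph" where
  "complement G = (verts G, {e. e \<subseteq> verts G \<and> card e = 2 \<and> e \<notin> edges G})"

definition induced :: "'a ugraph \<Rightarrow> 'a set \<Rightarrow> 'a ugraph" where
  "induced G S = (verts G \<inter> S, {e \<in> edges G. e \<subseteq> S})"

definition delete_verts :: "'a ugraph \<Rightarrow> 'a set \<Rightarrow> 'a ugraph" where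
  "delete_verts G S = induced G (verts G - S)"

definition delete_edge :: "'a ugraph \<Rightarrow> 'a set \<Rightarrow> 'a ugraph" where
  "delete_edge G e = (verts G, edges G - {e})"

definition has_induced :: "'a ugraph \<Rightarrow> 'b ugraph \<Rightarrow> bool" where
  "has_induced G H \<longleftrightarrow> (\<exists>S\<subseteq>verts G. induced G S \<simeq>\<^sub>g H)"

definition disjoint_union :: "'a ugraph \<Rightarrow> 'b ugraph \<Rightarrow> ('a + 'b) ugraph" where
  "disjoint_union G H =
     (Inl ` verts G \<union> Inr ` verts H, (`) Inl ` edges G \<union> (`) Inr ` edges H)"

definition complete_graph :: "'a ugraph \<Rightarrow> bool" where
  "complete_graph G \<longleftrightarrow> (\<forall>u\<in>verts G. \<forall>v\<in>verts G. u \<noteq> v \<longrightarrow> {u, v} \<in> edges G)"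

definition edgeless :: "'a ugraph \<Rightarrow> bool" where
  "edgeless G \<longleftrightarrow> edges G = {}"

definition path_graph :: "nat \<Rightarrow> nat ugraph" where
  "path_graph n = ({..<n}, {{i, Suc i} | i. Suc i < n})"

text \<open>Used only for \<open>n \<ge> 4\<close>.\<close>

definition cycle_graph :: "nat \<Rightarrow> nat ugraph" where
  "cycle_graph n = ({..<n}, {{i, Suc i mod n} | i. i < n})"

definition net :: "nat ugraph" where
  "net = ({..<6}, {{0, 1}, {0, 2}, {1, 2}} \<union> {{0, 3}, {1, 4}, {2, 5}})"

definition complete_bipartite :: "nat \<Rightarrow> nat \<Rightarrow> (nat + nat) ugraph" where
  "complete_bipartite m n =
     (Inl ` {..<m} \<union> Inr ` {..<n}, {{Inl i, Inr j} | i j. i < m \<and> j < n})"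

abbreviation star :: "nat \<Rightarrow> (nat + nat) ugraph" where
  "star \<equiv> complete_bipartite 1"

text \<open>The vertex \<open>Inl 0\<close> is the center of \<open>star a\<close>.\<close>

definition double_star :: "nat \<Rightarrow> nat \<Rightarrow> ((nat + nat) + (nat + nat)) ugraph" where
  "double_star a b =
     (let H = disjoint_union (star a) (star b)
      in (verts H, edges H \<union> {{Inl (Inl 0), Inr (Inl 0)}}))"

text \<open>The \<open>k\<close> parts are the residue classes modulo \<open>k\<close> of the vertices \<open>0, \<dots>, n - 1\<close>; their
  sizes differ by at most one. Used only for \<open>1 \<le> k \<le> n\<close>.\<close>

definition turan_graph :: "nat \<Rightarrow> nat \<Rightarrow> nat ugraph" where
  "turan_graph n k = ({..<n}, {{i, j} | i j. i < n \<and> j < n \<and> i mod k \<noteq> j mod k})"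

definition chordal :: "'a ugraph \<Rightarrow> bool" where
  "chordal G \<longleftrightarrow> (\<forall>n\<ge>4. \<not> has_induced G (cycle_graph n))"

definition co_chordal :: "'a ugraph \<Rightarrow> bool" where
  "co_chordal G \<longleftrightarrow> chordal (complement G)"

definition net_free :: "'a ugraph \<Rightarrow> bool" where
  "net_free G \<longleftrightarrow> \<not> has_induced G net"

definition reachable :: "'a ugraph \<Rightarrow> ('a \<times> 'a) set" where
  "reachable G = {(u, v). {u, v} \<in> edges G}\<^sup>* \<inter> verts G \<times> verts G"

definition conn_components :: "'a ugraph \<Rightarrow> 'a set set" where
  "conn_components G = verts G // reachable G"

definition num_components :: "'a ugraph \<Rightarrow> nat" where
  "num_components G = card (conn_components G)"

definition separator :: "'a ugraph \<Rightarrow> 'a set \<Rightarrow> bool" where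
  "separator G S \<longleftrightarrow> S \<subseteq> verts G \<and> num_components (delete_verts G S) \<ge> 2"

definition toughness :: "'a ugraph \<Rightarrow> ereal" where
  "toughness G =
     (if \<exists>S. separator G S
      then ereal (Min {real (card S) / real (num_components (delete_verts G S)) | S. separator G S})
      else \<infinity>)"

definition minimally_t_tough :: "ereal \<Rightarrow> 'a ugraph \<Rightarrow> bool" where
  "minimally_t_tough t G \<longleftrightarrow>
     toughness G = t \<and> (\<forall>e\<in>edges G. toughness (delete_edge G e) < t)"

definition minimally_tough :: "'a ugraph \<Rightarrow> bool" where
  "minimally_tough G \<longleftrightarrow> (\<exists>t. t \<noteq> -\<infinity> \<and> minimally_t_tough t G)"

definition nontrivially_minimally_tough :: "'a ugraph \<Rightarrow> bool" where
  "nontrivially_minimally_tough G \<longleftrightarrow> minimally_tough G \<and> \<not> complete_graph G \<and> \<not> edgeless G"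

end

theory Submission imports Defs begin

text \<open>Write \<open>H\<close> for the complement of \<open>G\<close>, \<open>n\<close> for the number of vertices and \<open>t\<close> for the toughness.

  Why the list is complete. Suppose \<open>G\<close> is minimally tough, neither complete nor edgeless. Since
  deleting an edge lowers the toughness, \<open>t > 0\<close>, so \<open>G\<close> has no isolated vertex and the chordal graph
  \<open>H\<close> has no universal vertex. The complement of the net is the 3-sun, and a chordal graph without
  universal vertex and without induced 3-sun contains two vertices at distance at least 3
  (\<open>vertices_far_apart\<close>); they can be moved to simplicial vertices \<open>u\<close>, \<open>v\<close>
  (\<open>simplicial_pair_far_apart\<close>). In \<open>G\<close> this says that \<open>uv\<close> is an edge, every other vertex is
  adjacent to \<open>u\<close> or \<open>v\<close>, and the non-neighbours of \<open>u\<close> form an independent set, as do those of \<open>v\<close>.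
  The edge \<open>uv\<close> is critical: some \<open>S\<close> has \<open>|S| < t c(G - uv - S)\<close>. By domination \<open>G - uv - S\<close> has at
  most two components, hence exactly two, and therefore \<open>|S| < 2 t\<close> while \<open>G - S\<close> is a double star with
  centres \<open>u\<close> and \<open>v\<close> (\<open>dominating_edge_double_star\<close>).

  Let \<open>a \<ge> b\<close> be the numbers of leaves. If \<open>S\<close> is empty, \<open>G\<close> itself is a double star: a star, \<open>P\<^sub>4\<close> or
  \<open>S\<^bsub>k,l\<^esub>\<close>. Otherwise \<open>t > 1/2\<close>, and separating the \<open>a\<close> leaves from the rest by \<open>S\<close> and their centre
  gives \<open>|S| + 1 \<ge> t (a + 1)\<close>. Since \<open>n = |S| + 2 + a + b\<close>, this leaves few possibilities. If
  \<open>a = 1\<close> and \<open>b = 0\<close>, then \<open>n - 3 < 2 t\<close>, so every three vertices induce a connected graph: \<open>H\<close> is a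
  matching, and \<open>G\<close> is one of the two complete multipartite graphs
  (\<open>nonadjacency_matching_if_tough\<close>). If \<open>a \<ge> 2\<close>, the two estimates force \<open>|S| = 1\<close> and \<open>a = 2\<close>, and
  \<open>G\<close> is \<open>K\<^bsub>2,3\<^esub>\<close> (\<open>many_leaves\<close>). If \<open>a = b = 1\<close>, a second critical edge yields a contradiction
  (\<open>one_leaf_each_impossible\<close>). The case \<open>a = 0\<close> contradicts \<open>2 t \<le> n - 2\<close>, which holds for any
  non-complete graph.

  Conversely, each listed graph is described by a structure that is preserved by isomorphism
  (\<open>double_star_at\<close>, \<open>bipartition\<close>, \<open>nonadjacency_matching\<close>), and for each structure a lower bound for
  the toughness and a better separator after deleting an edge are read off directly. Lower bounds
  for the number of components always come from a labelling of the vertices that is constant along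
  edges (\<open>num_components_ge_card_labels\<close>), upper bounds from a set of vertices that reaches all the others
  (\<open>num_components_le_card_cover\<close>).\<close>

section \<open>Adjacency, complements and induced subgraphs\<close>

abbreviation adj :: "'a ugraph \<Rightarrow> 'a \<Rightarrow> 'a \<Rightarrow> bool" where
  "adj G u v \<equiv> {u, v} \<in> edges G"

lemma adj_sym: "adj G u v \<longleftrightarrow> adj G v u"
  by (simp add: insert_commute)

lemma adj_vertsD:
  assumes "simple_graph G" "adj G u v"
  shows "u \<in> verts G" "v \<in> verts G" "u \<noteq> v"
  using assms unfolding simple_graph_def by (auto simp: card_insert_if split: if_splits)

lemma adj_complement:
  "adj (complement G) u v \<longleftrightarrow> u \<in> verts G \<and> v \<in> verts G \<and> u \<noteq> v \<and> \<not> adj G u v"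
  by (auto simp: complement_def card_insert_if)

lemma verts_complement [simp]: "verts (complement G) = verts G"
  by (simp add: complement_def)

lemma simple_complement: "simple_graph G \<Longrightarrow> simple_graph (complement G)"
  by (auto simp: simple_graph_def complement_def)

lemma complement_complement: "simple_graph G \<Longrightarrow> complement (complement G) = G"
  by (cases G) (auto simp: simple_graph_def complement_def)

lemma has_inducedI:
  assumes "inj_on g (verts F)" "g ` verts F \<subseteq> verts G"
    and "\<And>i j. i \<in> verts F \<Longrightarrow> j \<in> verts F \<Longrightarrow> adj F i j \<longleftrightarrow> adj G (g i) (g j)"
  shows "has_induced G F"
proof -
  let ?f = "inv_into (verts F) g"
  have v: "verts (induced G (g ` verts F)) = g ` verts F"
    using assms(2) by (auto simp: induced_def)
  have "bij_betw ?f (g ` verts F) (verts F)"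
    using assms(1) by (simp add: bij_betw_inv_into inj_on_imp_bij_betw)
  moreover have "adj (induced G (g ` verts F)) u v \<longleftrightarrow> adj F (?f u) (?f v)"
    if "u \<in> g ` verts F" "v \<in> g ` verts F" for u v
    using that assms(3) inv_into_f_f[OF assms(1)] by (auto simp: induced_def)
  ultimately have "induced G (g ` verts F) \<simeq>\<^sub>g F"
    unfolding graph_iso_def v by blast
  then show ?thesis
    using assms(2) unfolding has_induced_def by blast
qed

section \<open>Chordal graphs\<close>

definition connected_on :: "'a ugraph \<Rightarrow> 'a set \<Rightarrow> bool" where
  "connected_on H A \<longleftrightarrow>
     (\<forall>u\<in>A. \<forall>v\<in>A. (u, v) \<in> {(x, y). x \<in> A \<and> y \<in> A \<and> adj H x y}\<^sup>*)"

lemma connected_on_singleton: "connected_on H {v}"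
  by (simp add: connected_on_def)

lemma connected_on_insert:
  assumes "connected_on H A" "a \<in> A" "adj H a x"
  shows "connected_on H (insert x A)"
proof -
  let ?R = "\<lambda>A. {(x, y). x \<in> A \<and> y \<in> A \<and> adj H x y}"
  have mono: "(?R A)\<^sup>* \<subseteq> (?R (insert x A))\<^sup>*"
    by (rule rtrancl_mono) auto
  have ax: "(a, x) \<in> (?R (insert x A))\<^sup>*" "(x, a) \<in> (?R (insert x A))\<^sup>*"
    using assms(2,3) by (auto simp: adj_sym)
  have "(u, a) \<in> (?R (insert x A))\<^sup>* \<and> (a, u) \<in> (?R (insert x A))\<^sup>*" if "u \<in> insert x A" for u
    using that ax mono assms(1,2) unfolding connected_on_def by blast
  then show ?thesis
    unfolding connected_on_def by (meson rtrancl_trans)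
qed

text \<open>Strictly speaking these are walks: only minimality of the length \<open>k\<close> will rule out repetitions.\<close>

definition path_through :: "'a ugraph \<Rightarrow> 'a set \<Rightarrow> 'a \<Rightarrow> 'a \<Rightarrow> (nat \<Rightarrow> 'a) \<Rightarrow> nat \<Rightarrow> bool" where
  "path_through H A x y p k \<longleftrightarrow> p 0 = x \<and> p k = y \<and> (\<forall>i<k. adj H (p i) (p (Suc i))) \<and>
     (\<forall>i. 0 < i \<and> i < k \<longrightarrow> p i \<in> A)"

lemma path_through_exists:
  assumes "connected_on H A" "a \<in> A" "b \<in> A" "adj H x a" "adj H b y"
  shows "\<exists>p k. path_through H A x y p k"
proof -
  have "(a, b) \<in> {(x, y). x \<in> A \<and> y \<in> A \<and> adj H x y}\<^sup>*"
    using assms(1-3) unfolding connected_on_def by blast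
  then have "\<exists>p k. path_through H A x b p k \<and> b \<in> A"
  proof induction
    case base
    have "path_through H A x a (\<lambda>i. if i = 0 then x else a) 1"
      using assms(4) by (simp add: path_through_def)
    then show ?case using assms(2) by blast
  next
    case (step b c)
    then obtain p k where p: "path_through H A x b p k" "b \<in> A" "c \<in> A" "adj H b c" by auto
    have "path_through H A x c (p(Suc k := c)) (Suc k)"
      using p unfolding path_through_def by (auto simp: less_Suc_eq)
    then show ?case using p by blast
  qed
  then obtain p k where p: "path_through H A x b p k" "b \<in> A" by blast
  have "path_through H A x y (p(Suc k := y)) (Suc k)"
    using p assms(5) unfolding path_through_def by (auto simp: less_Suc_eq)
  then show ?thesis by blast
qed

text \<open>Skipping the \<open>d\<close> vertices after position \<open>i\<close>. The first alternative for the link covers the case that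
  the whole rest of the path is cut off because \<open>p i\<close> already is its end.\<close>

lemma path_through_shortcut:
  assumes p: "path_through H A x y p k"
    and link: "i + d = k \<and> p i = y \<or> i + d < k \<and> adj H (p i) (p (Suc (i + d)))"
  shows "path_through H A x y (\<lambda>m. if m \<le> i then p m else p (m + d)) (k - d)"
  unfolding path_through_def
proof (intro conjI allI impI)
  show "(if 0 \<le> i then p 0 else p (0 + d)) = x"
    using p by (simp add: path_through_def)
  show "(if k - d \<le> i then p (k - d) else p (k - d + d)) = y"
    using p link by (auto simp: path_through_def)
next
  fix m assume m: "m < k - d"
  have step: "adj H (p j) (p (Suc j))" if "j < k" for j
    using p that by (simp add: path_through_def)
  consider "m < i" | "m = i" | "m > i" by linarith
  then show "adj H (if m \<le> i then p m else p (m + d)) (if Suc m \<le> i then p (Suc m) else p (Suc m + d))"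
  proof cases
    case 1 then show ?thesis using step[of m] m by simp
  next
    case 2 then show ?thesis using link m by auto
  next
    case 3 then show ?thesis using step[of "m + d"] m by simp
  qed
next
  fix m assume "0 < m \<and> m < k - d"
  then show "(if m \<le> i then p m else p (m + d)) \<in> A"
    using p unfolding path_through_def by auto
qed

text \<open>A repetition or a chord would permit a shortcut.\<close>

lemma shortest_path_induced:
  assumes p: "path_through H A x y p k"
    and min: "\<And>q l. path_through H A x y q l \<Longrightarrow> k \<le> l"
    and ij: "i < j" "j \<le> k"
  shows "p i \<noteq> p j" "adj H (p i) (p j) \<Longrightarrow> j = Suc i"
proof -
  show "p i \<noteq> p j"
  proof
    assume eq: "p i = p j"
    have "i + (j - i) = k \<and> p i = y \<or> i + (j - i) < k \<and> adj H (p i) (p (Suc (i + (j - i))))"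
      using p ij eq by (cases "j = k") (auto simp: path_through_def)
    from min[OF path_through_shortcut[OF p this]] ij show False by simp
  qed
  assume e: "adj H (p i) (p j)"
  show "j = Suc i"
  proof (rule ccontr)
    assume "j \<noteq> Suc i"
    with ij have j: "Suc i < j" by simp
    then have "Suc (i + (j - Suc i)) = j" "i + (j - Suc i) < k" using ij by simp_all
    then have "i + (j - Suc i) = k \<and> p i = y \<or> i + (j - Suc i) < k \<and> adj H (p i) (p (Suc (i + (j - Suc i))))"
      using e by simp
    from min[OF path_through_shortcut[OF p this]] ij j show False by simp
  qed
qed

text \<open>For ordered indices the wrap-around edge is the only exception to consecutiveness.\<close>

lemma adj_cycle_graph:
  assumes "n \<ge> 4" "i < j" "j < n"
  shows "adj (cycle_graph n) i j \<longleftrightarrow> j = Suc i \<or> (i = 0 \<and> j = n - 1)"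
proof
  assume "adj (cycle_graph n) i j"
  then obtain m where m: "m < n" "{i, j} = {m, Suc m mod n}" by (auto simp: cycle_graph_def)
  show "j = Suc i \<or> (i = 0 \<and> j = n - 1)"
  proof (cases "Suc m = n")
    case True
    then show ?thesis using m assms by (auto simp: doubleton_eq_iff)
  next
    case False
    then have "Suc m mod n = Suc m" using m by simp
    then show ?thesis using m assms by (auto simp: doubleton_eq_iff)
  qed
next
  assume r: "j = Suc i \<or> (i = 0 \<and> j = n - 1)"
  show "adj (cycle_graph n) i j"
  proof (cases "j = Suc i")
    case True
    then have "{i, j} = {i, Suc i mod n} \<and> i < n" using assms by simp
    then show ?thesis unfolding cycle_graph_def snd_conv by blast
  next
    case False
    with r have "{i, j} = {n - 1, Suc (n - 1) mod n} \<and> n - 1 < n" using assms by auto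
    then show ?thesis unfolding cycle_graph_def snd_conv by blast
  qed
qed

text \<open>A shortest path from \<open>x\<close> to \<open>y\<close> with interior in \<open>A\<close> is induced; if \<open>x\<close> and \<open>y\<close> were not adjacent,
  it would have length at least 2 and form, together with \<open>c\<close>, an induced cycle of length at least 4.
  This is the only place where holes are constructed: all uses of chordality go through this lemma.\<close>

lemma chordal_neighbours_adjacent:
  assumes H: "simple_graph H" "chordal H"
    and A: "connected_on H A" "A \<subseteq> verts H"
    and c: "c \<notin> A" "\<And>a. a \<in> A \<Longrightarrow> \<not> adj H a c"
    and x: "x \<notin> A" "a \<in> A" "adj H a x" "adj H c x"
    and y: "y \<notin> A" "b \<in> A" "adj H b y" "adj H c y"
    and "x \<noteq> y"
  shows "adj H x y"
proof (rule ccontr)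
  assume nxy: "\<not> adj H x y"
  let ?P = "\<lambda>k. \<exists>p. path_through H A x y p k"
  have ex: "\<exists>k. ?P k"
    using path_through_exists[OF A(1) x(2) y(2) _ y(3), of x] x(3) by (auto simp: insert_commute)
  define k where "k = (LEAST k. ?P k)"
  obtain p where p: "path_through H A x y p k"
    using LeastI_ex[OF ex] unfolding k_def by blast
  have min: "k \<le> l" if "path_through H A x y q l" for q l
    unfolding k_def by (rule Least_le) (use that in blast)
  have ind: "p i \<noteq> p j" "adj H (p i) (p j) \<Longrightarrow> j = Suc i" if "i < j" "j \<le> k" for i j
    using shortest_path_induced[OF p _ that] min by blast+
  have p0: "p 0 = x" "p k = y" and pA: "\<And>i. 0 < i \<Longrightarrow> i < k \<Longrightarrow> p i \<in> A"
    and step: "\<And>i. i < k \<Longrightarrow> adj H (p i) (p (Suc i))"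
    using p by (auto simp: path_through_def)
  have "k \<noteq> 0" using p0 \<open>x \<noteq> y\<close> by metis
  moreover have "k \<noteq> 1" using p0 nxy step[of 0] by (metis One_nat_def zero_less_one)
  ultimately have k2: "k \<ge> 2" by simp
  define n where "n = k + 2"
  define g where "g i = (if i \<le> k then p i else c)" for i
  have n4: "n \<ge> 4" using k2 by (simp add: n_def)
  have cx: "c \<noteq> x" "c \<noteq> y" using x y adj_vertsD[OF H(1)] by blast+
  have pc: "p i \<noteq> c" if "i \<le> k" for i
  proof (cases "i = 0 \<or> i = k")
    case True then show ?thesis using p0 cx by auto
  next
    case False then show ?thesis using pA[of i] that c(1) by auto
  qed
  have adjc: "adj H (p i) c \<longleftrightarrow> i = 0 \<or> i = k" if "i \<le> k" for i
  proof (cases "i = 0 \<or> i = k")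
    case True then show ?thesis using p0 x(4) y(4) by (auto simp: adj_sym)
  next
    case False then show ?thesis using pA[of i] that c(2) by auto
  qed
  have less: "g i \<noteq> g j \<and> (adj (cycle_graph n) i j \<longleftrightarrow> adj H (g i) (g j))" if "i < j" "j < n" for i j
  proof (cases "j \<le> k")
    case True
    then have "adj H (p i) (p j) \<longleftrightarrow> j = Suc i"
      using ind(2)[OF \<open>i < j\<close> True] step[of i] that by auto
    moreover have "adj (cycle_graph n) i j \<longleftrightarrow> j = Suc i"
      using adj_cycle_graph[OF n4 that] True by (auto simp: n_def)
    ultimately show ?thesis using True ind(1)[OF \<open>i < j\<close> True] that by (simp add: g_def)
  next
    case False
    then have j: "j = Suc k" using that by (simp add: n_def)
    then show ?thesis using adj_cycle_graph[OF n4 that] adjc[of i] pc[of i] that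
      by (auto simp: g_def n_def)
  qed
  have "has_induced H (cycle_graph n)"
  proof (rule has_inducedI)
    have vc: "verts (cycle_graph n) = {..<n}" by (simp add: cycle_graph_def)
    show "inj_on g (verts (cycle_graph n))"
      unfolding vc using less by (intro linorder_inj_onI) auto
    show "g ` verts (cycle_graph n) \<subseteq> verts H"
    proof -
      have "c \<in> verts H" "x \<in> verts H" "y \<in> verts H" using x y adj_vertsD[OF H(1)] by blast+
      then have "g i \<in> verts H" for i
        using pA[of i] A(2) p0 unfolding g_def by (cases "i = 0 \<or> i = k") auto
      then show ?thesis by blast
    qed
    fix i j assume ij: "i \<in> verts (cycle_graph n)" "j \<in> verts (cycle_graph n)"
    consider "i < j" | "i = j" | "j < i" by linarith
    then show "adj (cycle_graph n) i j \<longleftrightarrow> adj H (g i) (g j)"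
    proof cases
      case 1 then show ?thesis using less ij vc by auto
    next
      case 2
      have "\<not> adj H (g j) (g j)" using adj_vertsD(3)[OF H(1)] by blast
      moreover have "Suc m mod n \<noteq> m" if "m < n" for m
        using that n4 by (cases "Suc m = n") auto
      then have "\<not> adj (cycle_graph n) j j" by (auto simp: cycle_graph_def)
      ultimately show ?thesis using 2 by simp
    next
      case 3 then show ?thesis using less[of j i] ij vc by (auto simp: insert_commute)
    qed
  qed
  then show False using H(2) n4 unfolding chordal_def by blast
qed

text \<open>The special case of a single vertex \<open>A = {b}\<close>.\<close>

lemma chordal_four_cycle:
  assumes "simple_graph H" "chordal H"
    and "adj H a b" "adj H b c" "adj H c d" "adj H d a" "b \<noteq> d" "a \<noteq> c"
  shows "adj H a c \<or> adj H b d"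
proof (rule disjCI)
  assume "\<not> adj H b d"
  show "adj H a c"
  proof (rule chordal_neighbours_adjacent[OF assms(1,2) connected_on_singleton[of H b], of d a b c b])
    show "{b} \<subseteq> verts H" using adj_vertsD[OF assms(1)] assms(3) by blast
    show "a \<notin> {b}" "c \<notin> {b}" using adj_vertsD[OF assms(1)] assms(3,4) by blast+
  qed (use assms \<open>\<not> adj H b d\<close> in \<open>auto simp: insert_commute\<close>)
qed

text \<open>Choose \<open>A\<close> maximal among the connected sets that contain \<open>A0\<close> and leave some vertex of \<open>W\<close> undominated;
  \<open>Q\<close> is its neighbourhood and \<open>C\<close> the undominated rest. Adding \<open>x \<in> Q\<close> to \<open>A\<close> keeps it connected, so by
  maximality nothing is left undominated: \<open>x\<close> is adjacent to all of \<open>C\<close>. Two vertices of \<open>Q\<close> then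
  have a common neighbour in \<open>C\<close> and neighbours in \<open>A\<close>, which makes \<open>Q\<close> a clique.\<close>

lemma maximal_nondominating_set:
  assumes H: "simple_graph H" "chordal H"
    and W: "W \<subseteq> verts H" and A0: "A0 \<subseteq> W" "A0 \<noteq> {}" "connected_on H A0"
    and v: "v \<in> W" "v \<notin> A0" "\<And>a. a \<in> A0 \<Longrightarrow> \<not> adj H a v"
  obtains A Q C where "A0 \<subseteq> A" "W = A \<union> Q \<union> C" "A \<inter> Q = {}" "A \<inter> C = {}" "Q \<inter> C = {}" "C \<noteq> {}"
    "\<forall>a\<in>A. \<forall>c\<in>C. \<not> adj H a c" "\<forall>x\<in>Q. \<forall>c\<in>C. adj H x c"
    "\<forall>x\<in>Q. \<forall>y\<in>Q. x \<noteq> y \<longrightarrow> adj H x y"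
proof -
  let ?far = "\<lambda>A. {c \<in> W - A. \<forall>a\<in>A. \<not> adj H a c}"
  define F where "F = {A. A \<subseteq> W \<and> A0 \<subseteq> A \<and> connected_on H A \<and> ?far A \<noteq> {}}"
  have finW: "finite W" using W H(1) finite_subset by (auto simp: simple_graph_def)
  have "F \<subseteq> Pow W" unfolding F_def by blast
  then have "finite F" using finW by (simp add: finite_subset)
  moreover have "A0 \<in> F" unfolding F_def using A0 v by auto
  ultimately obtain A where "A \<in> F" and max: "\<forall>B\<in>F. A \<subseteq> B \<longrightarrow> A = B"
    using finite_has_maximal2[of F A0] by auto
  then have A: "A \<subseteq> W" "A0 \<subseteq> A" "connected_on H A" "?far A \<noteq> {}"
    unfolding F_def by blast+
  define C where "C = ?far A"
  define Q where "Q = W - A - C"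
  have QA: "\<exists>a\<in>A. adj H a x" if "x \<in> Q" for x
    using that by (auto simp: Q_def C_def)
  have QC: "adj H x c" if x: "x \<in> Q" and c: "c \<in> C" for x c
  proof (rule ccontr)
    assume n: "\<not> adj H x c"
    obtain a where "a \<in> A" "adj H a x" using QA x by blast
    then have "connected_on H (insert x A)" using A connected_on_insert[of H A a x] by simp
    moreover have "c \<in> ?far (insert x A)" using n x c by (auto simp: C_def Q_def)
    ultimately have "insert x A \<in> F" using A x unfolding F_def by (auto simp: Q_def)
    then have "insert x A = A" using max by (metis subset_insertI)
    then show False using x by (auto simp: Q_def)
  qed
  have QQ: "adj H x y" if xy: "x \<in> Q" "y \<in> Q" "x \<noteq> y" for x y
  proof -
    obtain c where c: "c \<in> C" using A by (auto simp: C_def)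
    obtain a b where ab: "a \<in> A" "adj H a x" "b \<in> A" "adj H b y" using QA xy by blast
    have "adj H c x" "adj H c y" using QC[of x c] QC[of y c] xy c by (simp_all add: insert_commute)
    moreover have "c \<notin> A" "\<And>a. a \<in> A \<Longrightarrow> \<not> adj H a c" using c by (auto simp: C_def)
    moreover have "x \<notin> A" "y \<notin> A" using xy by (auto simp: Q_def)
    moreover have "A \<subseteq> verts H" "connected_on H A" using A W by auto
    ultimately show ?thesis
      using chordal_neighbours_adjacent[OF H, of A c x a y b] ab xy by blast
  qed
  show thesis
  proof (rule that[of A Q C])
    show "C \<noteq> {}" using A(4) by (simp add: C_def)
    show "W = A \<union> Q \<union> C" using A(1) by (auto simp: C_def Q_def)
    show "A \<inter> C = {}" "\<forall>a\<in>A. \<forall>c\<in>C. \<not> adj H a c" by (auto simp: C_def)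
    show "A \<inter> Q = {}" "Q \<inter> C = {}" by (auto simp: Q_def)
  qed (use A(2) QC QQ in auto)
qed

text \<open>Relative to a vertex set \<open>W\<close>, because induction over induced subgraphs is done by shrinking \<open>W\<close> inside
  one fixed graph.\<close>

definition simplicial_in :: "'a ugraph \<Rightarrow> 'a set \<Rightarrow> 'a \<Rightarrow> bool" where
  "simplicial_in H W s \<longleftrightarrow> s \<in> W \<and>
     (\<forall>x\<in>W. \<forall>y\<in>W. adj H s x \<and> adj H s y \<and> x \<noteq> y \<longrightarrow> adj H x y)"

abbreviation simplicial :: "'a ugraph \<Rightarrow> 'a \<Rightarrow> bool" where
  "simplicial H \<equiv> simplicial_in H (verts H)"

text \<open>In the decomposition \<open>W = A \<union> Q \<union> C\<close> above, a vertex simplicial in \<open>C\<close> is simplicial in \<open>W\<close>: its neighbours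
  lie in \<open>Q \<union> C\<close>, and \<open>Q\<close> is a clique joined completely to \<open>C\<close>. As \<open>C\<close> is smaller than \<open>W\<close>, induction
  provides a simplicial vertex of \<open>C\<close>, unless \<open>C\<close> is a clique, where any vertex will do.\<close>

lemma simplicial_outside_neighbourhood:
  assumes H: "simple_graph H" "chordal H"
    and "W \<subseteq> verts H" "A0 \<subseteq> W" "A0 \<noteq> {}" "connected_on H A0"
    and "v \<in> W" "v \<notin> A0" "\<And>a. a \<in> A0 \<Longrightarrow> \<not> adj H a v"
  shows "\<exists>s. simplicial_in H W s \<and> s \<notin> A0 \<and> (\<forall>a\<in>A0. \<not> adj H a s)"
proof -
  have "finite W" using assms(3) H(1) finite_subset by (auto simp: simple_graph_def)
  then show ?thesis
    using assms(3-)
  proof (induction W arbitrary: A0 v rule: finite_psubset_induct)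
    case (psubset W)
    obtain A Q C where d: "A0 \<subseteq> A" "W = A \<union> Q \<union> C" "A \<inter> Q = {}" "A \<inter> C = {}" "Q \<inter> C = {}" "C \<noteq> {}"
      and far: "\<forall>a\<in>A. \<forall>c\<in>C. \<not> adj H a c" "\<forall>x\<in>Q. \<forall>c\<in>C. adj H x c"
        "\<forall>x\<in>Q. \<forall>y\<in>Q. x \<noteq> y \<longrightarrow> adj H x y"
      by (rule maximal_nondominating_set[OF H psubset.prems])
    have AC: "\<not> adj H a c" if "a \<in> A" "c \<in> C" for a c using far that by blast
    have QC: "adj H x c" if "x \<in> Q" "c \<in> C" for x c using far that by blast
    have QQ: "adj H x y" if "x \<in> Q" "y \<in> Q" "x \<noteq> y" for x y using far that by blast
    have "\<exists>s. simplicial_in H C s"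
    proof (cases "\<forall>x\<in>C. \<forall>y\<in>C. x \<noteq> y \<longrightarrow> adj H x y")
      case True
      then show ?thesis using d(6) by (auto simp: simplicial_in_def)
    next
      case False
      then obtain x y where xy: "x \<in> C" "y \<in> C" "x \<noteq> y" "\<not> adj H x y" by blast
      have "C \<subset> W" using d(1,2,4) psubset.prems(3) by blast
      then show ?thesis
        using psubset.IH[of C "{x}" y] xy psubset.prems(1) connected_on_singleton[of H x] by auto
    qed
    then obtain s where s: "simplicial_in H C s" by blast
    have "adj H x y" if xy: "x \<in> W" "y \<in> W" "adj H s x" "adj H s y" "x \<noteq> y" for x y
    proof -
      have "s \<in> C" using s by (simp add: simplicial_in_def)
      then have "x \<in> Q \<union> C" "y \<in> Q \<union> C"
        using xy(1-4) d(2) AC[of x s] AC[of y s] by (auto simp: insert_commute)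
      then show ?thesis
        using s xy QQ[of x y] QC[of x y] QC[of y x] by (auto simp: simplicial_in_def insert_commute)
    qed
    then have "simplicial_in H W s" using s d(2) by (auto simp: simplicial_in_def)
    moreover have "s \<notin> A0" "\<forall>a\<in>A0. \<not> adj H a s"
      using s d AC by (auto simp: simplicial_in_def)
    ultimately show ?case by blast
  qed
qed

lemma simplicial_vertex_exists:
  assumes H: "simple_graph H" "chordal H" and W: "W \<subseteq> verts H" "W \<noteq> {}"
  shows "\<exists>s. simplicial_in H W s"
proof (cases "\<forall>x\<in>W. \<forall>y\<in>W. x \<noteq> y \<longrightarrow> adj H x y")
  case True
  then show ?thesis using W(2) by (auto simp: simplicial_in_def)
next
  case False
  then obtain x y where xy: "x \<in> W" "y \<in> W" "x \<noteq> y" "\<not> adj H x y" by blast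
  have "\<exists>s. simplicial_in H W s \<and> s \<notin> {x} \<and> (\<forall>a\<in>{x}. \<not> adj H a s)"
    by (rule simplicial_outside_neighbourhood[OF H W(1), of "{x}" y])
      (use xy connected_on_singleton[of H x] in auto)
  then show ?thesis by blast
qed

text \<open>The 3-sun has the central triangle \<open>x, y, z\<close> and the tips \<open>a, b, c\<close>, each tip adjacent to all of the
  triangle but one vertex. In the complement the tips form a triangle, and the missing edges
  \<open>ax\<close>, \<open>by\<close>, \<open>cz\<close> become the pendant edges of the net.\<close>

lemma net_in_complement_of_sun:
  assumes H: "simple_graph H"
    and tri: "adj H x y" "adj H y z" "adj H x z"
    and tips: "adj H a y" "adj H a z" "adj H b x" "adj H b z" "adj H c x" "adj H c y"
    and non: "\<not> adj H a x" "\<not> adj H b y" "\<not> adj H c z" "\<not> adj H a b" "\<not> adj H b c" "\<not> adj H a c"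
    and ne: "a \<noteq> x" "b \<noteq> y" "c \<noteq> z"
  shows "has_induced (complement H) net"
proof -
  note n = adj_vertsD[OF H]
  have dist: "distinct [a, b, c, x, y, z]"
    using tri tips non ne n(3) by (auto simp: insert_commute)
  have V: "{a, b, c, x, y, z} \<subseteq> verts H" using tri tips n by blast
  let ?g = "\<lambda>i. [a, b, c, x, y, z] ! i"
  have vn: "verts net = {0, 1, 2, 3, 4, 5}" by (auto simp: net_def)
  show ?thesis
  proof (rule has_inducedI)
    show "inj_on ?g (verts net)"
      using dist unfolding vn by (auto simp: inj_on_def)
    show "?g ` verts net \<subseteq> verts (complement H)"
      using V unfolding vn by auto
    have sym: "adj H p q \<longleftrightarrow> adj H q p" for p q by (simp add: insert_commute)
    note rev = sym[of y x] sym[of z y] sym[of z x] sym[of y a] sym[of z a] sym[of x b] sym[of z b]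
      sym[of x c] sym[of y c] sym[of x a] sym[of y b] sym[of z c] sym[of b a] sym[of c b] sym[of c a]
    have V': "a \<in> verts H" "b \<in> verts H" "c \<in> verts H" "x \<in> verts H" "y \<in> verts H" "z \<in> verts H"
      using V by auto
    have ne': "a \<noteq> b" "a \<noteq> c" "a \<noteq> x" "a \<noteq> y" "a \<noteq> z" "b \<noteq> c" "b \<noteq> x" "b \<noteq> y" "b \<noteq> z"
       "c \<noteq> x" "c \<noteq> y" "c \<noteq> z" "x \<noteq> y" "x \<noteq> z" "y \<noteq> z"
      using dist by auto
    fix i j assume "i \<in> verts net" "j \<in> verts net"
    then show "adj net i j \<longleftrightarrow> adj (complement H) (?g i) (?g j)"
      unfolding vn adj_complement
      by (elim insertE emptyE; hypsubst)
        (simp_all add: net_def doubleton_eq_iff V' tri tips non rev ne' ne'[symmetric])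
  qed
qed

lemma not_psubset_if_card_le: "finite B \<Longrightarrow> card B \<le> card A \<Longrightarrow> \<not> A \<subset> B"
  by (metis leD psubset_card_mono)

lemma ex_max_nat:
  fixes f :: "'a \<Rightarrow> nat"
  assumes "finite S" "S \<noteq> {}"
  shows "\<exists>x\<in>S. \<forall>y\<in>S. f y \<le> f x"
proof -
  have "Max (f ` S) \<in> f ` S" using assms by simp
  then obtain x where "x \<in> S" "Max (f ` S) = f x" by blast
  then show ?thesis using assms(1) by (metis Max_ge finite_imageI imageI)
qed

text \<open>Suppose all distances are at most 2, and decompose \<open>H\<close> into \<open>A\<close>, \<open>Q\<close>, \<open>C\<close> as above. A fixed
  \<open>c \<in> C\<close> and a vertex of \<open>A\<close> have a common neighbour, necessarily in \<open>Q\<close>; so \<open>Q\<close> dominates \<open>A\<close>. No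
  \<open>x \<in> Q\<close> is adjacent to all of \<open>A\<close>, since it would be universal. Take \<open>x \<in> Q\<close> with as many neighbours
  in \<open>A\<close> as possible, \<open>a \<in> A\<close> not adjacent to \<open>x\<close>, and among the \<open>y \<in> Q\<close> adjacent to \<open>a\<close> one that shares as
  many neighbours in \<open>A\<close> with \<open>x\<close> as possible. The choice of \<open>x\<close> gives \<open>b \<in> A\<close> adjacent to \<open>x\<close> but not to \<open>y\<close>.
  A common neighbour \<open>p\<close> of \<open>a\<close> and \<open>b\<close> completes the triangle \<open>x, y, p\<close> of a 3-sun with the tips \<open>a\<close>, \<open>b\<close>;
  the third tip is \<open>c\<close> if \<open>p \<in> A\<close>, and if \<open>p \<in> Q\<close>, the choice of \<open>y\<close> supplies one.\<close>

lemma vertices_far_apart: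
  assumes H: "simple_graph H" "chordal H" and net: "net_free (complement H)"
    and ne: "verts H \<noteq> {}" and nu: "\<And>v. v \<in> verts H \<Longrightarrow> \<exists>w\<in>verts H. w \<noteq> v \<and> \<not> adj H v w"
  obtains u v where "u \<in> verts H" "v \<in> verts H" "u \<noteq> v" "\<not> adj H u v" "\<And>w. \<not> (adj H u w \<and> adj H v w)"
proof (rule ccontr)
  note pair = that
  assume "\<not> thesis"
  then have common: "\<exists>w. adj H u w \<and> adj H v w"
    if "u \<in> verts H" "v \<in> verts H" "u \<noteq> v" "\<not> adj H u v" for u v
    using that pair[of u v] by blast
  obtain v0 w0 where v0: "v0 \<in> verts H" "w0 \<in> verts H" "w0 \<noteq> v0" "\<not> adj H v0 w0"
    using ne nu by blast
  obtain A Q C where d: "{v0} \<subseteq> A" "verts H = A \<union> Q \<union> C" "A \<inter> Q = {}" "A \<inter> C = {}" "Q \<inter> C = {}" "C \<noteq> {}"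
      and far: "\<forall>a\<in>A. \<forall>c\<in>C. \<not> adj H a c" "\<forall>x\<in>Q. \<forall>c\<in>C. adj H x c"
        "\<forall>x\<in>Q. \<forall>y\<in>Q. x \<noteq> y \<longrightarrow> adj H x y"
    by (rule maximal_nondominating_set[OF H subset_refl, of "{v0}" w0])
      (use v0 connected_on_singleton[of H v0] in auto)
  have AC: "\<not> adj H a c" if "a \<in> A" "c \<in> C" for a c using far that by blast
  have QC: "adj H x c" if "x \<in> Q" "c \<in> C" for x c using far that by blast
  have QQ: "adj H x y" if "x \<in> Q" "y \<in> Q" "x \<noteq> y" for x y using far that by blast
  have fin: "finite A" "finite Q" using H(1) d(2) by (auto simp: simple_graph_def)
  obtain c where c: "c \<in> C" using d(6) by blast
  have sym: "adj H p q \<longleftrightarrow> adj H q p" for p q by (simp add: insert_commute)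
  have dom: "\<exists>x\<in>Q. adj H x a" if "a \<in> A" for a
  proof -
    have "a \<noteq> c" "\<not> adj H a c" "a \<in> verts H" "c \<in> verts H" using that c d AC by auto
    then obtain w where w: "adj H a w" "adj H c w" using common by blast
    then have "w \<in> verts H" using adj_vertsD[OF H(1)] by blast
    moreover have "w \<notin> A" using w AC[of w c] c by (auto simp: insert_commute)
    moreover have "w \<notin> C" using w AC[of a w] that by auto
    ultimately show ?thesis using w d by (auto simp: insert_commute)
  qed
  have "Q \<noteq> {}" using dom d(1) by blast
  then obtain x where x: "x \<in> Q" and xmax: "\<And>y. y \<in> Q \<Longrightarrow> card {p\<in>A. adj H y p} \<le> card {p\<in>A. adj H x p}"
    using ex_max_nat[OF fin(2), of "\<lambda>y. card {p\<in>A. adj H y p}"] by blast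
  obtain a where a: "a \<in> A" "\<not> adj H x a"
  proof -
    have "x \<in> verts H" using x d(2) by blast
    then obtain w where w: "w \<in> verts H" "w \<noteq> x" "\<not> adj H x w" using nu by blast
    then have "w \<in> A" using d(2) QC[OF x] QQ[OF x] by blast
    then show thesis using that w(3) by blast
  qed
  let ?I = "\<lambda>y. {p\<in>A. adj H x p \<and> adj H y p}"
  let ?Qa = "{y\<in>Q. adj H y a}"
  have "?Qa \<noteq> {}" "finite ?Qa" using dom[OF a(1)] fin(2) by auto
  then obtain y where "y \<in> ?Qa" and ymax: "\<forall>z\<in>?Qa. card (?I z) \<le> card (?I y)"
    using ex_max_nat[of ?Qa "\<lambda>y. card (?I y)"] by blast
  then have y: "y \<in> Q" "adj H y a" by auto
  have xy: "x \<noteq> y" "adj H x y" using x y a(2) QQ by auto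
  obtain b where b: "b \<in> A" "adj H x b" "\<not> adj H y b"
  proof -
    have "\<not> {p\<in>A. adj H x p} \<subset> {p\<in>A. adj H y p}"
      by (rule not_psubset_if_card_le[OF _ xmax[OF y(1)]]) (simp add: fin(1))
    moreover have "a \<in> {p\<in>A. adj H y p} - {p\<in>A. adj H x p}" using a y by simp
    ultimately show thesis using that by blast
  qed
  have "a \<noteq> b" using a(2) b(2) by blast
  moreover have "\<not> adj H a b"
    using chordal_four_cycle[OF H, of a b x y] a b y xy sym[of b x] sym[of a x] sym[of b y]
      d(3) x by blast
  ultimately have ab: "\<not> adj H a b" "a \<noteq> b" by auto
  obtain p where p: "adj H a p" "adj H b p"
    using common[of a b] a(1) b(1) d(2) ab by blast
  have pne: "p \<noteq> x" "p \<noteq> y" using p a b sym by auto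
  have "p \<in> verts H" using p adj_vertsD[OF H(1)] by blast
  moreover have "p \<notin> C" using p a(1) AC by blast
  ultimately consider "p \<in> A" | "p \<in> Q" using d(2) by blast
  then have "has_induced (complement H) net"
  proof cases
    case 1
    \<comment> \<open>The 5-cycle \<open>p a y x b\<close> lacks the chords \<open>ax\<close>, \<open>by\<close>, \<open>ab\<close>; so both \<open>px\<close> and \<open>py\<close> are edges.\<close>
    have conn: "connected_on H {p, a}" "connected_on H {p, b}"
      using connected_on_insert[OF connected_on_singleton[of H a], of a p]
        connected_on_insert[OF connected_on_singleton[of H b], of b p] p by simp_all
    have px: "adj H p x"
    proof (rule ccontr)
      assume "\<not> adj H p x"
      then have "adj H y b"
        using chordal_neighbours_adjacent[OF H conn(1), of x y a b p] 1 a b p x y xy d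
        by (auto simp: insert_commute)
      then show False using b by simp
    qed
    have py: "adj H p y"
    proof (rule ccontr)
      assume "\<not> adj H p y"
      then have "adj H x a"
        using chordal_neighbours_adjacent[OF H conn(2), of y x b a p] 1 a b p x y xy d
        by (auto simp: insert_commute)
      then show False using a by simp
    qed
    have "adj H y p" "adj H x p" "adj H a y" "adj H b x" "\<not> adj H a x" "\<not> adj H b y"
      using px py y(2) b a(2) by (simp_all add: insert_commute)
    moreover have "adj H c x" "adj H c y" "\<not> adj H c p" "\<not> adj H b c" "\<not> adj H a c"
      using QC[OF x c] QC[OF y(1) c] AC[OF 1 c] AC[OF a(1) c] AC[OF b(1) c]
      by (simp_all add: insert_commute)
    moreover have "a \<noteq> x" "b \<noteq> y" "c \<noteq> p" using a b c 1 x y d(3,4) by blast+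
    ultimately show ?thesis
      using net_in_complement_of_sun[OF H(1), of x y p a b c] xy(2) p ab(1) by blast
  next
    case 2
    \<comment> \<open>\<open>p\<close> also competes for the choice of \<open>y\<close>, and \<open>b\<close> is a shared neighbour that only \<open>p\<close> has.\<close>
    obtain q where q: "q \<in> A" "adj H x q" "adj H y q" "\<not> adj H p q"
    proof -
      have "p \<in> ?Qa" using 2 p by (simp add: insert_commute)
      then have "\<not> ?I y \<subset> ?I p"
        using not_psubset_if_card_le[OF _ bspec[OF ymax, of p]] fin(1) by simp
      moreover have "b \<in> ?I p - ?I y" using b p(2) sym[of p b] by simp
      ultimately show thesis using that by blast
    qed
    have pxy: "adj H p x" "adj H p y" using QQ 2 x y pne by auto
    have ne: "a \<noteq> x" "b \<noteq> y" "q \<noteq> p" using a b q(1) 2 x y d(3) by blast+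
    have e: "adj H y p" "adj H x p" "adj H a y" "adj H b x" "adj H q x" "adj H q y" "adj H p a" "adj H p b"
      "\<not> adj H a x" "\<not> adj H b y" "\<not> adj H q p"
      using pxy y(2) b a(2) q p by (simp_all add: insert_commute)
    have "\<not> adj H a q"
      using chordal_four_cycle[OF H, of a q x p] e ne q pxy by blast
    moreover have "\<not> adj H b q"
      using chordal_four_cycle[OF H, of b q y p] e ne q pxy by blast
    ultimately show ?thesis
      using net_in_complement_of_sun[OF H(1), of x y p a b q] xy(2) p ab(1) e ne by blast
  qed
  then show False using net by (simp add: net_free_def)
qed

text \<open>If some vertex has distance at least 3 from \<open>u\<close>, then some simplicial vertex has, because the closed
  neighbourhood of \<open>u\<close> is a connected set that does not dominate \<open>H\<close>. Apply this twice to replace both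
  vertices of a pair.\<close>

lemma simplicial_pair_far_apart:
  assumes H: "simple_graph H" "chordal H" and net: "net_free (complement H)"
    and ne: "verts H \<noteq> {}" and nu: "\<And>v. v \<in> verts H \<Longrightarrow> \<exists>w\<in>verts H. w \<noteq> v \<and> \<not> adj H v w"
  obtains s t where "simplicial H s" "simplicial H t" "s \<noteq> t" "\<not> adj H s t"
    "\<forall>w. \<not> (adj H s w \<and> adj H t w)"
proof -
  have far: "\<exists>s. simplicial H s \<and> s \<noteq> u \<and> \<not> adj H u s \<and> (\<forall>w. \<not> (adj H u w \<and> adj H s w))"
    if uv: "u \<in> verts H" "v \<in> verts H" "u \<noteq> v" "\<not> adj H u v" "\<And>w. \<not> (adj H u w \<and> adj H v w)" for u v
  proof -
    let ?N = "insert u {w. adj H u w}"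
    have star: "(u, w) \<in> {(x, y). x \<in> ?N \<and> y \<in> ?N \<and> adj H x y}\<^sup>* \<and>
          (w, u) \<in> {(x, y). x \<in> ?N \<and> y \<in> ?N \<and> adj H x y}\<^sup>*" if "w \<in> ?N" for w
      using that by (auto simp: insert_commute intro!: r_into_rtrancl)
    have "connected_on H ?N"
      unfolding connected_on_def using star by (meson rtrancl_trans)
    moreover have "?N \<subseteq> verts H" using uv(1) adj_vertsD[OF H(1)] by blast
    ultimately obtain s where "simplicial H s" "s \<notin> ?N" "\<forall>a\<in>?N. \<not> adj H a s"
      using simplicial_outside_neighbourhood[OF H subset_refl, of ?N v] uv
      by (auto simp: insert_commute)
    then show ?thesis by (auto simp: insert_commute)
  qed
  obtain u v where "u \<in> verts H" "v \<in> verts H" "u \<noteq> v" "\<not> adj H u v" "\<And>w. \<not> (adj H u w \<and> adj H v w)"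
    using vertices_far_apart[OF assms] by blast
  then obtain s where s: "simplicial H s" "s \<noteq> u" "\<not> adj H u s" "\<forall>w. \<not> (adj H u w \<and> adj H s w)"
    using far by blast
  then obtain t where "simplicial H t" "t \<noteq> s" "\<not> adj H s t" "\<forall>w. \<not> (adj H s w \<and> adj H t w)"
  proof -
    have "s \<in> verts H" using s(1) by (simp add: simplicial_in_def)
    moreover have "\<not> adj H s u" using s(3) by (simp add: insert_commute)
    ultimately show thesis using far[of s u] s \<open>u \<in> verts H\<close> that by blast
  qed
  then show thesis using that[of s t] s(1) by blast
qed

section \<open>Counting components and bounding toughness\<close>

lemma verts_delete_verts [simp]: "verts (delete_verts G S) = verts G - S"
  by (auto simp: delete_verts_def induced_def)

lemma adj_delete_verts:
  assumes "simple_graph G"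
  shows "adj (delete_verts G S) u v \<longleftrightarrow> adj G u v \<and> u \<notin> S \<and> v \<notin> S"
  using adj_vertsD[OF assms] by (auto simp: delete_verts_def induced_def)

lemma verts_delete_edge [simp]: "verts (delete_edge G e) = verts G"
  by (simp add: delete_edge_def)

lemma simple_delete_edge: "simple_graph G \<Longrightarrow> simple_graph (delete_edge G e)"
  by (auto simp: simple_graph_def delete_edge_def)

lemma equiv_reachable: "equiv (verts G) (reachable G)"
proof (rule equivI)
  have "sym {(u, v). adj G u v}" by (auto simp: sym_def insert_commute)
  then show "sym (reachable G)"
    unfolding reachable_def by (intro sym_Int sym_rtrancl) (auto simp: sym_def)
  show "trans (reachable G)"
    unfolding reachable_def by (intro trans_Int trans_rtrancl) (auto simp: trans_def)
qed (auto simp: reachable_def refl_on_def)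

text \<open>A label that is constant along edges is constant on components.\<close>

lemma num_components_ge_card_labels:
  assumes "finite (verts G)" and f: "\<And>u v. adj G u v \<Longrightarrow> f u = f v"
  shows "card (f ` verts G) \<le> num_components G"
proof -
  have lab: "f u = f v" if "(u, v) \<in> reachable G" for u v
  proof -
    have "(u, v) \<in> {(u, v). adj G u v}\<^sup>*" using that by (simp add: reachable_def)
    then show ?thesis by induction (use f in auto)
  qed
  have "f ` verts G \<subseteq> (\<lambda>X. f (SOME x. x \<in> X)) ` conn_components G"
  proof
    fix y assume "y \<in> f ` verts G"
    then obtain v where v: "v \<in> verts G" "y = f v" by blast
    let ?X = "reachable G `` {v}"
    have "v \<in> ?X" using v(1) by (simp add: reachable_def)
    then have "(SOME x. x \<in> ?X) \<in> ?X" by (rule someI)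
    then have "y = f (SOME x. x \<in> ?X)" using lab v(2) by blast
    moreover have "?X \<in> conn_components G"
      using v(1) by (simp add: conn_components_def quotientI)
    ultimately show "y \<in> (\<lambda>X. f (SOME x. x \<in> X)) ` conn_components G" by blast
  qed
  moreover have "finite (conn_components G)"
    unfolding conn_components_def using assms(1)
    by (rule finite_quotient) (auto simp: reachable_def)
  ultimately show ?thesis unfolding num_components_def by (rule surj_card_le[rotated])
qed

lemma num_components_le_card_cover:
  assumes "finite T" and "\<And>v. v \<in> verts G \<Longrightarrow> \<exists>w\<in>T. (w, v) \<in> reachable G"
  shows "num_components G \<le> card T"
proof -
  have "conn_components G \<subseteq> (\<lambda>w. reachable G `` {w}) ` T"
  proof
    fix X assume "X \<in> conn_components G"
    then obtain v where v: "v \<in> verts G" "X = reachable G `` {v}"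
      unfolding conn_components_def by (auto elim: quotientE)
    then obtain w where w: "w \<in> T" "(w, v) \<in> reachable G" using assms(2) by blast
    then have "reachable G `` {w} = X" using equiv_class_eq[OF equiv_reachable] v(2) by metis
    then show "X \<in> (\<lambda>w. reachable G `` {w}) ` T" using w(1) by blast
  qed
  then show ?thesis unfolding num_components_def using assms(1) by (metis surj_card_le)
qed

lemma num_components_le_card_verts: "finite (verts G) \<Longrightarrow> num_components G \<le> card (verts G)"
  by (rule num_components_le_card_cover) (auto simp: reachable_def)

lemma reachable_adj: "adj G u v \<Longrightarrow> u \<in> verts G \<Longrightarrow> v \<in> verts G \<Longrightarrow> (u, v) \<in> reachable G"
  by (auto simp: reachable_def)

lemma reachable_trans: "(u, v) \<in> reachable G \<Longrightarrow> (v, w) \<in> reachable G \<Longrightarrow> (u, w) \<in> reachable G"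
  using equiv_reachable[of G] unfolding equiv_def trans_def by blast

lemma reachable_refl: "v \<in> verts G \<Longrightarrow> (v, v) \<in> reachable G"
  by (simp add: reachable_def)

lemma toughness_set_finite:
  assumes "finite (verts G)"
  shows "finite {real (card S) / real (num_components (delete_verts G S)) | S. separator G S}"
proof -
  have "finite {S. separator G S}"
    by (rule finite_subset[of _ "Pow (verts G)"]) (auto simp: separator_def assms)
  then show ?thesis by simp
qed

lemma toughness_le:
  assumes "finite (verts G)" "separator G S"
  shows "toughness G \<le> ereal (real (card S) / real (num_components (delete_verts G S)))"
  using assms(2) toughness_set_finite[OF assms(1)] unfolding toughness_def by (auto intro!: Min_le)

lemma toughness_eq_separator:
  assumes "finite (verts G)" "separator G S0"
  obtains S where "separator G S"
    "toughness G = ereal (real (card S) / real (num_components (delete_verts G S)))"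
proof -
  let ?M = "{real (card S) / real (num_components (delete_verts G S)) | S. separator G S}"
  have "Min ?M \<in> ?M" by (rule Min_in) (use assms toughness_set_finite in blast)+
  then obtain S where S: "separator G S"
    "Min ?M = real (card S) / real (num_components (delete_verts G S))" by blast
  have "toughness G = ereal (Min ?M)" using assms(2) unfolding toughness_def by auto
  then show thesis using that S by simp
qed

lemma separator_toughness_less:
  assumes "finite (verts G)" "toughness G < ereal t"
  obtains S where "separator G S" "real (card S) < t * real (num_components (delete_verts G S))"
proof -
  obtain S0 where "separator G S0"
    using assms(2) unfolding toughness_def by (auto split: if_splits)
  then obtain S where S: "separator G S"
    "toughness G = ereal (real (card S) / real (num_components (delete_verts G S)))"
    using toughness_eq_separator[OF assms(1)] by metis
  have "real (num_components (delete_verts G S)) > 0" using S(1) by (simp add: separator_def)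
  then have "real (card S) < t * real (num_components (delete_verts G S))"
    using S(2) assms(2) by (simp add: divide_less_eq)
  then show thesis using that S(1) by blast
qed

text \<open>The form in which toughness is used as a lower bound: keep \<open>X\<close>, delete everything else, and
  certify the number of components by a labelling.\<close>

lemma toughness_bound:
  assumes G: "simple_graph G" "ereal t \<le> toughness G" "0 \<le> t" and X: "X \<subseteq> verts G"
    and f: "\<And>u v. u \<in> X \<Longrightarrow> v \<in> X \<Longrightarrow> adj G u v \<Longrightarrow> f u = f v"
    and k: "k \<le> card (f ` X)" "2 \<le> k"
  shows "t * real k \<le> real (card (verts G)) - real (card X)"
proof -
  let ?S = "verts G - X"
  have fin: "finite (verts G)" using G(1) by (simp add: simple_graph_def)
  have v: "verts (delete_verts G ?S) = X" using X by auto
  have "card (f ` X) \<le> num_components (delete_verts G ?S)"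
    using num_components_ge_card_labels[of "delete_verts G ?S" f] fin f X
      adj_vertsD[OF G(1)] unfolding adj_delete_verts[OF G(1)] v by (metis Diff_iff finite_subset)
  then have c: "k \<le> num_components (delete_verts G ?S)" using k by simp
  then have "separator G ?S" using k(2) by (simp add: separator_def)
  then have "ereal t \<le> ereal (real (card ?S) / real (num_components (delete_verts G ?S)))"
    using toughness_le[OF fin] G(2) order_trans by blast
  moreover have "real (num_components (delete_verts G ?S)) > 0" using c k(2) by simp
  ultimately have "t * real (num_components (delete_verts G ?S)) \<le> real (card ?S)"
    by (simp add: le_divide_eq)
  moreover have "t * real k \<le> t * real (num_components (delete_verts G ?S))"
    using c G(3) by (intro mult_left_mono) auto
  moreover have "real (card ?S) = real (card (verts G)) - real (card X)"
    using card_Diff_subset[of X "verts G"] X fin card_mono[OF fin X] finite_subset[OF X fin] by simp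
  ultimately show ?thesis by linarith
qed

text \<open>If a separator \<open>S\<close> that witnesses \<open>\<tau>(G - uv) < t\<close> met \<open>{u, v}\<close>, then \<open>G - uv - S = G - S\<close>, which would
  contradict \<open>\<tau>(G) \<ge> t\<close>. So \<open>u\<close> and \<open>v\<close> survive, and as they dominate \<open>G\<close>, every vertex of \<open>G - uv - S\<close> is
  joined to one of them. There are thus exactly two components, one containing \<open>u\<close> and one containing \<open>v\<close>;
  the paths \<open>u w v\<close> and \<open>u w w' v\<close> excluded in the conclusion would connect them. \<open>X\<close> is the complement of \<open>S\<close>.\<close>

lemma critical_dominating_edge:
  assumes G: "simple_graph G" "ereal t \<le> toughness G"
    and e: "adj G u v" "toughness (delete_edge G {u, v}) < ereal t"
    and dom: "\<And>w. w \<in> verts G \<Longrightarrow> w \<noteq> u \<Longrightarrow> w \<noteq> v \<Longrightarrow> adj G u w \<or> adj G v w"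
  obtains X where "X \<subseteq> verts G" "u \<in> X" "v \<in> X" "real (card (verts G)) - real (card X) < 2 * t"
    "\<forall>w\<in>X. \<not> (adj G u w \<and> adj G v w)"
    "\<forall>w\<in>X - {v}. \<forall>w'\<in>X - {u}. adj G u w \<and> adj G v w' \<longrightarrow> \<not> adj G w w'"
proof -
  have fin: "finite (verts G)" using G(1) by (simp add: simple_graph_def)
  let ?G' = "delete_edge G {u, v}"
  have sG': "simple_graph ?G'" using G(1) by (rule simple_delete_edge)
  obtain S where S: "separator ?G' S" "real (card S) < t * real (num_components (delete_verts ?G' S))"
    using separator_toughness_less[OF _ e(2)] fin by auto
  let ?D = "delete_verts ?G' S"
  have SV: "S \<subseteq> verts G" using S(1) by (simp add: separator_def)
  have uv: "u \<notin> S \<and> v \<notin> S"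
  proof (rule ccontr)
    assume "\<not> (u \<notin> S \<and> v \<notin> S)"
    then have "?D = delete_verts G S"
      by (auto simp: delete_verts_def induced_def delete_edge_def)
    then have "separator G S" and c: "real (card S) < t * real (num_components (delete_verts G S))"
      using S by (simp_all add: separator_def)
    then have "ereal t \<le> ereal (real (card S) / real (num_components (delete_verts G S)))"
      and "real (num_components (delete_verts G S)) > 0"
      using toughness_le[OF fin] G(2) order_trans by (blast, simp add: separator_def)
    then show False using c by (simp add: le_divide_eq)
  qed
  have adjD: "adj ?D x y \<longleftrightarrow> adj G x y \<and> {x, y} \<noteq> {u, v} \<and> x \<notin> S \<and> y \<notin> S" for x y
    unfolding adj_delete_verts[OF sG'] by (auto simp: delete_edge_def)
  have V: "u \<in> verts ?D" "v \<in> verts ?D" "u \<noteq> v" using adj_vertsD[OF G(1) e(1)] uv by auto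
  have reach: "(x, y) \<in> reachable ?D" if "adj G x y" "{x, y} \<noteq> {u, v}" "x \<notin> S" "y \<notin> S" for x y
    using reachable_adj[of x y ?D] adjD[of x y] adj_vertsD[OF G(1)] that by auto
  have cov: "\<exists>x\<in>{u, v}. (x, w) \<in> reachable ?D" if w: "w \<in> verts ?D" for w
  proof (cases "w = u \<or> w = v")
    case True then show ?thesis using reachable_refl[OF V(1)] reachable_refl[OF V(2)] by auto
  next
    case False
    then have "adj G u w \<or> adj G v w" using dom w by simp
    moreover have "{u, w} \<noteq> {u, v}" "{v, w} \<noteq> {u, v}" using False V(3) by (auto simp: doubleton_eq_iff)
    moreover have "w \<notin> S" using w by simp
    ultimately show ?thesis using reach[of u w] reach[of v w] uv by blast
  qed
  have "num_components ?D \<le> 2"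
    using num_components_le_card_cover[of "{u, v}" ?D, OF _ cov] V(3) by simp
  moreover have "num_components ?D \<ge> 2" using S(1) by (simp add: separator_def)
  ultimately have two: "num_components ?D = 2" by simp
  have nr: "(u, v) \<notin> reachable ?D"
  proof
    assume r: "(u, v) \<in> reachable ?D"
    have "\<exists>x\<in>{u}. (x, w) \<in> reachable ?D" if "w \<in> verts ?D" for w
      using cov[OF that] reachable_trans[OF r, of w] by blast
    from num_components_le_card_cover[OF _ this] two show False by simp
  qed
  have no_common: "\<not> (adj G u w \<and> adj G v w)" if w: "w \<in> verts G - S" for w
  proof
    assume a: "adj G u w \<and> adj G v w"
    have "w \<noteq> u" "w \<noteq> v" using a adj_vertsD(3)[OF G(1)] by blast+
    moreover have "{u, w} \<noteq> {u, v}" "{w, v} \<noteq> {u, v}"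
      using \<open>w \<noteq> u\<close> \<open>w \<noteq> v\<close> by (metis doubleton_eq_iff)+
    moreover have "w \<notin> S" "adj G w v" using w a adj_sym[of w v G] by blast+
    ultimately have "(u, w) \<in> reachable ?D" "(w, v) \<in> reachable ?D"
      using reach[of u w] reach[of w v] a uv by blast+
    then show False using nr reachable_trans[of u w ?D v] by blast
  qed
  have no_link: "\<not> adj G w w'"
    if w: "w \<in> verts G - S - {v}" "w' \<in> verts G - S - {u}" and a: "adj G u w" "adj G v w'" for w w'
  proof
    assume b: "adj G w w'"
    have ne: "w \<noteq> u" "w' \<noteq> v" using adj_vertsD(3)[OF G(1)] a by blast+
    moreover have "{u, w} \<noteq> {u, v}" "{w, w'} \<noteq> {u, v}" "{w', v} \<noteq> {u, v}"
      using ne w by (metis Diff_iff doubleton_eq_iff insertI1)+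
    moreover have "w \<notin> S" "w' \<notin> S" "adj G w' v" using w a adj_sym[of w' v G] by blast+
    ultimately have "(u, w) \<in> reachable ?D" "(w, w') \<in> reachable ?D" "(w', v) \<in> reachable ?D"
      by (intro reach; use a b uv in blast)+
    then show False using nr reachable_trans[of u w ?D w'] reachable_trans[of u w' ?D v] by blast
  qed
  show thesis
  proof (rule that[of "verts G - S"])
    show "u \<in> verts G - S" "v \<in> verts G - S" using V by auto
    have "real (card (verts G - S)) = real (card (verts G)) - real (card S)"
      using card_Diff_subset[of S "verts G"] SV fin card_mono[OF fin SV] finite_subset[OF SV fin] by simp
    then show "real (card (verts G)) - real (card (verts G - S)) < 2 * t" using S(2) two by simp
  qed (use no_common no_link in blast)+
qed

section \<open>Structures of the listed graphs\<close>

text \<open>The complement of the relation on \<open>V\<close> has maximum degree at most 1, and at most one vertex is unmatched: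
  the complete multipartite graphs whose parts have size 2, except possibly for one part of size 1.\<close>

definition nonadjacency_matching :: "('a \<Rightarrow> 'a \<Rightarrow> bool) \<Rightarrow> 'a set \<Rightarrow> bool" where
  "nonadjacency_matching E V \<longleftrightarrow>
     (\<forall>v\<in>V. \<forall>x\<in>V - {v}. \<forall>y\<in>V - {v}. \<not> E v x \<and> \<not> E v y \<longrightarrow> x = y) \<and>
     (\<forall>x\<in>V. \<forall>y\<in>V. (\<forall>z\<in>V - {x}. E x z) \<and> (\<forall>z\<in>V - {y}. E y z) \<longrightarrow> x = y)"

text \<open>The set \<open>{u, v} \<union> A \<union> B\<close> induces a double star: \<open>A\<close> are the leaves at \<open>u\<close> and \<open>B\<close> those at \<open>v\<close>. Either set may
  be empty, so stars are included.\<close>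

definition double_star_at :: "'a ugraph \<Rightarrow> 'a \<Rightarrow> 'a \<Rightarrow> 'a set \<Rightarrow> 'a set \<Rightarrow> bool" where
  "double_star_at G u v A B \<longleftrightarrow> adj G u v \<and> v \<notin> A \<and> u \<notin> B \<and>
     (\<forall>a\<in>A. adj G u a \<and> \<not> adj G v a) \<and> (\<forall>b\<in>B. adj G v b \<and> \<not> adj G u b) \<and>
     (\<forall>x\<in>A \<union> B. \<forall>y\<in>A \<union> B. \<not> adj G x y)"

lemma double_star_at_swap: "double_star_at G u v A B \<Longrightarrow> double_star_at G v u B A"
  unfolding double_star_at_def by (auto simp: insert_commute)

lemma double_star_at_distinct:
  assumes "simple_graph G" "double_star_at G u v A B"
  shows "u \<noteq> v" "u \<notin> A" "v \<notin> A" "u \<notin> B" "v \<notin> B" "A \<inter> B = {}" "A \<subseteq> verts G" "B \<subseteq> verts G"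
  using assms(2) adj_vertsD[OF assms(1)] unfolding double_star_at_def by blast+

lemma card_double_star_at:
  assumes "simple_graph G" "double_star_at G u v A B"
  shows "card (insert u (insert v (A \<union> B))) = 2 + card A + card B"
proof -
  note d = double_star_at_distinct[OF assms]
  have "finite A" "finite B"
    using d(7,8) assms(1) finite_subset by (auto simp: simple_graph_def)
  then show ?thesis using d(1-6) by (simp add: card_Un_disjoint)
qed

section \<open>Minimally tough graphs around a dominating edge\<close>

text \<open>A simplicial vertex of the complement is one whose non-neighbours are independent.\<close>

lemma cosimplicial_nonneighbours:
  assumes "simplicial (complement G) s" "x \<in> verts G" "y \<in> verts G" "x \<noteq> s" "y \<noteq> s"
    "\<not> adj G s x" "\<not> adj G s y" "simple_graph G"
  shows "\<not> adj G x y"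
proof (cases "x = y")
  case True then show ?thesis using adj_vertsD(3)[OF assms(8), of x y] by blast
next
  case False
  have "s \<in> verts G" using assms(1) by (simp add: simplicial_in_def)
  then have "adj (complement G) s x" "adj (complement G) s y"
    using assms unfolding adj_complement by auto
  then have "adj (complement G) x y"
    using assms(1-3) False unfolding simplicial_in_def verts_complement by blast
  then show ?thesis by (simp add: adj_complement)
qed

context
  fixes G :: "'a ugraph" and t :: real
  assumes simple: "simple_graph G" and tough: "toughness G = ereal t" and t_pos: "0 < t"
    and critical: "\<forall>u v. adj G u v \<longrightarrow> toughness (delete_edge G {u, v}) < ereal t"
begin

private abbreviation "n \<equiv> real (card (verts G))"

private lemma finite_verts: "finite (verts G)"
  using simple by (simp add: simple_graph_def)

private lemma sym: "adj G x y \<longleftrightarrow> adj G y x"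
  by (simp add: insert_commute)

private lemma irrefl: "\<not> adj G x x"
  using adj_vertsD(3)[OF simple, of x x] by blast

lemma labels_bound:
  assumes "X \<subseteq> verts G" "\<And>x y. x \<in> X \<Longrightarrow> y \<in> X \<Longrightarrow> adj G x y \<Longrightarrow> f x = f y"
    "k \<le> card (f ` X)" "2 \<le> k"
  shows "t * real k \<le> n - real (card X)"
  by (rule toughness_bound[OF simple _ _ assms]) (use tough t_pos in auto)

lemma isolated_bound:
  assumes "X \<subseteq> verts G" "x \<in> X" "y \<in> X" "x \<noteq> y" "\<And>z. z \<in> X \<Longrightarrow> \<not> adj G x z"
  shows "2 * t \<le> n - real (card X)"
proof -
  have "(\<lambda>z. z = x) ` X = {True, False}" using assms(2-4) by auto
  then have c: "2 \<le> card ((\<lambda>z. z = x) ` X)" by simp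
  have "t * real 2 \<le> n - real (card X)"
  proof (rule labels_bound[OF assms(1) _ c])
    fix a b assume "a \<in> X" "b \<in> X" "adj G a b"
    then show "(a = x) = (b = x)" using assms(5) sym by blast
  qed simp
  then show ?thesis by simp
qed

lemma nonadjacent_bound:
  assumes "x \<in> verts G" "y \<in> verts G" "x \<noteq> y" "\<not> adj G x y"
  shows "2 * t \<le> n - 2"
proof -
  have "2 * t \<le> n - real (card {x, y})"
    by (rule isolated_bound[of _ x y]) (use assms irrefl in auto)
  then show ?thesis using assms(3) by simp
qed

lemma dominating_edge:
  assumes "adj G u v" "\<And>w. w \<in> verts G \<Longrightarrow> w \<noteq> u \<Longrightarrow> w \<noteq> v \<Longrightarrow> adj G u w \<or> adj G v w"
  obtains X where "X \<subseteq> verts G" "u \<in> X" "v \<in> X" "n - real (card X) < 2 * t"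
    "\<forall>w\<in>X. \<not> (adj G u w \<and> adj G v w)"
    "\<forall>w\<in>X - {v}. \<forall>w'\<in>X - {u}. adj G u w \<and> adj G v w' \<longrightarrow> \<not> adj G w w'"
  by (rule critical_dominating_edge[OF simple _ assms(1) critical[rule_format, OF assms(1)] assms(2)])
    (use tough that in \<open>auto simp only: order_refl\<close>)

text \<open>Every remaining vertex other than \<open>u\<close> and \<open>v\<close> is adjacent to exactly one of them. Those adjacent to \<open>u\<close>
  are non-neighbours of \<open>v\<close>, hence independent by simpliciality of \<open>v\<close> in the complement, and vice versa.\<close>

lemma dominating_edge_double_star:
  assumes uv: "adj G u v"
    and s: "simplicial (complement G) u" "simplicial (complement G) v"
    and dom: "\<And>w. w \<in> verts G \<Longrightarrow> w \<noteq> u \<Longrightarrow> w \<noteq> v \<Longrightarrow> adj G u w \<or> adj G v w"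
  obtains A B where "double_star_at G u v A B" "n - (2 + real (card A) + real (card B)) < 2 * t"
proof -
  obtain X where X: "X \<subseteq> verts G" "u \<in> X" "v \<in> X" "n - real (card X) < 2 * t"
    and nc: "\<forall>w\<in>X. \<not> (adj G u w \<and> adj G v w)"
    and ne: "\<forall>w\<in>X - {v}. \<forall>w'\<in>X - {u}. adj G u w \<and> adj G v w' \<longrightarrow> \<not> adj G w w'"
    by (rule dominating_edge[OF uv dom])
  define A where "A = {w \<in> X - {v}. adj G u w}"
  define B where "B = {w \<in> X - {u}. adj G v w}"
  have AA: "\<not> adj G x y" if "x \<in> A" "y \<in> A" for x y
    using that nc X(1) cosimplicial_nonneighbours[OF s(2) _ _ _ _ _ _ simple, of x y]
    unfolding A_def by blast
  have BB: "\<not> adj G x y" if "x \<in> B" "y \<in> B" for x y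
    using that nc X(1) cosimplicial_nonneighbours[OF s(1) _ _ _ _ _ _ simple, of x y]
    unfolding B_def by blast
  have AB: "\<not> adj G x y \<and> \<not> adj G y x" if "x \<in> A" "y \<in> B" for x y
    using that ne sym[of x y] unfolding A_def B_def by blast
  have ds: "double_star_at G u v A B"
    unfolding double_star_at_def
  proof (intro conjI ballI)
    fix x y assume "x \<in> A \<union> B" "y \<in> A \<union> B"
    then show "\<not> adj G x y" using AA BB AB by blast
  qed (use uv nc in \<open>auto simp: A_def B_def\<close>)
  have "X = insert u (insert v (A \<union> B))"
    using X(1-3) dom unfolding A_def B_def by blast
  then have "card X = 2 + card A + card B" using card_double_star_at[OF simple ds] by simp
  then show thesis using that ds X(4) by simp
qed

text \<open>Removing \<open>u\<close> together with the vertices outside the double star isolates every leaf in \<open>A\<close> and leaves the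
  star around \<open>v\<close> as one more component.\<close>

lemma double_star_bound:
  assumes ds: "double_star_at G u v A B" and "A \<noteq> {}"
  shows "t * (real (card A) + 1) \<le> n - (1 + real (card A) + real (card B))"
proof -
  note d = double_star_at_distinct[OF simple ds]
  have fin: "finite A" "finite B" using d(7,8) finite_verts finite_subset by blast+
  have adjs: "adj G u v" "\<forall>a\<in>A. \<not> adj G v a" "\<forall>x\<in>A\<union>B. \<forall>y\<in>A\<union>B. \<not> adj G x y"
    using ds unfolding double_star_at_def by auto
  let ?X = "insert v (A \<union> B)" and ?f = "\<lambda>w. if w \<in> A then w else v"
  have "?f ` ?X = insert v A" using d(6) by auto
  then have c: "card A + 1 \<le> card (?f ` ?X)" using d(3) fin by simp
  have "t * real (card A + 1) \<le> n - real (card ?X)"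
  proof (rule labels_bound[OF _ _ c])
    show "?X \<subseteq> verts G" using d(7,8) adj_vertsD[OF simple adjs(1)] by blast
    show "2 \<le> card A + 1" using assms(2) fin by (simp add: Suc_le_eq card_gt_0_iff)
    fix x y assume "x \<in> ?X" "y \<in> ?X" "adj G x y"
    then have "x \<notin> A" "y \<notin> A" using adjs sym by blast+
    then show "?f x = ?f y" by simp
  qed
  moreover have "card ?X = 1 + card A + card B" using d fin by (simp add: card_Un_disjoint)
  ultimately show ?thesis by (simp add: algebra_simps)
qed

text \<open>If \<open>v\<close> had two non-neighbours \<open>x\<close>, \<open>y\<close>, keeping only \<open>v, x, y\<close> would isolate \<open>v\<close> and give \<open>2 t \<le> n - 3\<close>. If
  two vertices were universal, the edge between them could only be critical for the separator formed
  by all other vertices, which gives \<open>n - 2 < 2 t\<close>; but any non-adjacent pair shows \<open>2 t \<le> n - 2\<close>.\<close>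

lemma nonadjacency_matching_if_tough:
  assumes "x0 \<in> verts G" "y0 \<in> verts G" "x0 \<noteq> y0" "\<not> adj G x0 y0" and small: "n - 3 < 2 * t"
  shows "nonadjacency_matching (adj G) (verts G)"
  unfolding nonadjacency_matching_def
proof (intro conjI ballI impI)
  fix v x y
  assume a: "v \<in> verts G" "x \<in> verts G - {v}" "y \<in> verts G - {v}" "\<not> adj G v x \<and> \<not> adj G v y"
  show "x = y"
  proof (rule ccontr)
    assume "x \<noteq> y"
    have "2 * t \<le> n - real (card {v, x, y})"
      by (rule isolated_bound[of _ v x]) (use a irrefl in auto)
    then show False using small \<open>x \<noteq> y\<close> a by auto
  qed
next
  fix x y
  assume a: "x \<in> verts G" "y \<in> verts G"
    "(\<forall>z\<in>verts G - {x}. adj G x z) \<and> (\<forall>z\<in>verts G - {y}. adj G y z)"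
  show "x = y"
  proof (rule ccontr)
    assume "x \<noteq> y"
    then have xy: "adj G x y" using a by blast
    obtain X where X: "X \<subseteq> verts G" "n - real (card X) < 2 * t" "\<forall>w\<in>X. \<not> (adj G x w \<and> adj G y w)"
      by (rule dominating_edge[OF xy]) (use a in auto)
    have "X \<subseteq> {x, y}" using X(1,3) a by blast
    then have "card X \<le> 2" using card_mono[of "{x, y}" X] \<open>x \<noteq> y\<close> by simp
    then show False using X(2) nonadjacent_bound[OF assms(1-4)] by simp
  qed
qed

text \<open>A separator that makes \<open>zu\<close> critical has fewer than \<open>2 t \<le> 2\<close> vertices, but must contain both common
  neighbours.\<close>

lemma common_neighbours_impossible:
  assumes "adj G z u" "\<And>w. w \<in> verts G \<Longrightarrow> w \<noteq> z \<Longrightarrow> w \<noteq> u \<Longrightarrow> adj G z w \<or> adj G u w"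
    and c: "adj G z c" "adj G u c" "adj G z c'" "adj G u c'" "c \<noteq> c'" and t1: "t \<le> 1"
  shows False
proof -
  obtain X where X: "X \<subseteq> verts G" "n - real (card X) < 2 * t" "\<forall>w\<in>X. \<not> (adj G z w \<and> adj G u w)"
    by (rule dominating_edge[OF assms(1,2)])
  have "X \<subseteq> verts G - {c, c'}" using X(1,3) c by blast
  moreover have "c \<in> verts G" "c' \<in> verts G" using c adj_vertsD[OF simple] by blast+
  moreover from this have "card (verts G - {c, c'}) = card (verts G) - 2"
    using finite_verts c(5) by (simp add: card_Diff_subset)
  ultimately have "card X \<le> card (verts G) - 2" "2 \<le> card (verts G)"
    using finite_verts card_mono[of "verts G - {c, c'}" X] card_mono[of "verts G" "{c, c'}"] c(5) by auto
  then show False using X(2) t1 by linarith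
qed

text \<open>Here \<open>|R| < 2 t \<le> |R| + 1\<close> and \<open>n = |R| + 4\<close>. Keeping four vertices that induce a disconnected graph would
  give \<open>2 t \<le> |R|\<close>; this forces every vertex of \<open>R\<close> to be adjacent to both leaves, and then, since
  the non-neighbours of \<open>u\<close> and of \<open>v\<close> are independent, to \<open>u\<close> and \<open>v\<close> as well. Pick \<open>z \<in> R\<close> simplicial in the
  complement and consider the critical edge \<open>zu\<close>. The separator contains the common neighbours \<open>v\<close>
  and \<open>a\<close>, so only \<open>z\<close>, \<open>u\<close>, possibly \<open>b\<close>, and some non-neighbours of \<open>z\<close> in \<open>R\<close> remain. If \<open>b\<close> remains, it excludes
  the latter, and the separator has at least \<open>|R| + 1\<close> vertices. Otherwise the remaining part \<open>K\<close>
  of \<open>R\<close> is independent; its size must be at least 3, which is too large for the toughness.\<close>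

lemma one_leaf_each_impossible:
  assumes ds: "double_star_at G u v {a} {b}" and R: "R \<noteq> {}" "R \<inter> {u, v, a, b} = {}"
    and V: "verts G = R \<union> {u, v, a, b}"
    and s: "simplicial (complement G) u" "simplicial (complement G) v" and chordal: "chordal (complement G)"
    and small: "real (card R) < 2 * t"
  shows False
proof -
  note d = double_star_at_distinct[OF simple ds]
  have dd: "u \<noteq> v" "u \<noteq> a" "v \<noteq> a" "u \<noteq> b" "v \<noteq> b" "a \<noteq> b" using d by auto
  have adjs: "adj G u v" "adj G u a" "\<not> adj G v a" "adj G v b" "\<not> adj G u b" "\<not> adj G a b"
    using ds unfolding double_star_at_def by auto
  have finR: "finite R" using V finite_verts by simp
  have R4: "card {u, v, a, b} = 4" using dd by simp
  have n: "n = real (card R) + 4"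
    using card_Un_disjoint[OF finR _ R(2)] R4 V by simp
  have "2 * t \<le> n - (1 + real (card {a}) + real (card {b}))"
    using double_star_bound[OF ds] by simp
  then have large: "2 * t \<le> real (card R) + 1" using n by simp
  have leaf: "adj G z a \<and> adj G z b" if z: "z \<in> R" for z
  proof -
    have "z \<noteq> u" "z \<noteq> v" "z \<noteq> a" "z \<noteq> b" using z R(2) by blast+
    then have card: "card {u, a, b, z} = 4" "card {v, a, b, z} = 4" using dd by auto
    have "adj G z a"
    proof (rule ccontr)
      assume na: "\<not> adj G z a"
      have "2 * t \<le> n - real (card {v, a, b, z})"
        by (rule isolated_bound[of _ a b]) (use na adjs V z dd irrefl sym in auto)
      then show False using card n small by simp
    qed
    moreover have "adj G z b"
    proof (rule ccontr)
      assume nb: "\<not> adj G z b"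
      have "2 * t \<le> n - real (card {u, a, b, z})"
        by (rule isolated_bound[of _ b a]) (use nb adjs V z dd irrefl sym in auto)
      then show False using card n small by simp
    qed
    ultimately show ?thesis ..
  qed
  have centre: "adj G z u \<and> adj G z v" if z: "z \<in> R" for z
  proof -
    have ne: "z \<noteq> u" "z \<noteq> v" "z \<in> verts G" "a \<in> verts G" "b \<in> verts G" using z R(2) V by auto
    have "adj G u z"
      using cosimplicial_nonneighbours[OF s(1), of b z] adjs dd ne simple leaf[OF z] sym[of b z] by blast
    moreover have "adj G v z"
      using cosimplicial_nonneighbours[OF s(2), of a z] adjs dd ne simple leaf[OF z] sym[of a z] by blast
    ultimately show ?thesis using sym by blast
  qed
  have RV: "R \<subseteq> verts (complement G)" using V by auto
  obtain z where zR: "simplicial_in (complement G) R z"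
    using simplicial_vertex_exists[OF simple_complement[OF simple] chordal RV R(1)] by blast
  have z: "z \<in> R" using zR by (simp add: simplicial_in_def)
  have zu: "adj G z u" using centre z by blast
  obtain X where X: "X \<subseteq> verts G" "z \<in> X" "u \<in> X" "n - real (card X) < 2 * t"
    "\<forall>w\<in>X. \<not> (adj G z w \<and> adj G u w)"
    "\<forall>w\<in>X - {u}. \<forall>w'\<in>X - {z}. adj G z w \<and> adj G u w' \<longrightarrow> \<not> adj G w w'"
  proof (rule dominating_edge[OF zu])
    fix w assume "w \<in> verts G" "w \<noteq> z" "w \<noteq> u"
    then show "adj G z w \<or> adj G u w" using V centre leaf[OF z] centre[OF z] sym adjs by blast
  qed
  define K where "K = X \<inter> R"
  have nv: "v \<notin> X" "a \<notin> X" using X(5) adjs centre[OF z] leaf[OF z] by blast+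
  then have XK: "X \<subseteq> insert u (insert b K)" using X(1) V unfolding K_def by blast
  have finK: "finite K" using finR unfolding K_def by simp
  show False
  proof (cases "b \<in> X")
    case True
    have "K \<subseteq> {z}"
    proof
      fix w assume w: "w \<in> K"
      then have "w \<in> R" "w \<in> X" unfolding K_def by auto
      moreover from this have "adj G u w" "adj G b w" using centre leaf sym by blast+
      moreover have "adj G z b" "b \<noteq> u" using leaf[OF z] dd by auto
      ultimately show "w \<in> {z}" using X(6) True by blast
    qed
    then have "X \<subseteq> {u, b, z}" using XK by blast
    then have "card X \<le> card {u, b, z}" by (rule card_mono[rotated]) simp
    also have "\<dots> \<le> 3" by (simp add: card_insert_if)
    finally have "card X \<le> 3" .
    then show False using X(4) n large by simp
  next
    case False
    then have XuK: "X = insert u K" using XK X(3) unfolding K_def by blast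
    moreover have uK: "u \<notin> K" using R(2) unfolding K_def by blast
    ultimately have cX: "card X = card K + 1" using finK by simp
    \<comment> \<open>\<open>n - |X| = |R| + 3 - |K|\<close>, which lies below \<open>2 t \<le> |R| + 1\<close>.\<close>
    have "card K \<ge> 3" using X(4) n large cX by linarith
    have ind: "\<not> adj G x y" if xy: "x \<in> K" "y \<in> K" for x y
    proof -
      have nz: "\<not> adj G z w" if "w \<in> K" for w
        using X(5) that centre sym unfolding K_def by blast
      have KR: "K \<subseteq> R" "R \<subseteq> verts G" using V unfolding K_def by auto
      show ?thesis
      proof (cases "x = z \<or> y = z \<or> x = y")
        case True then show ?thesis using nz xy sym irrefl by blast
      next
        case False
        then have "adj (complement G) z x" "adj (complement G) z y"
          using nz xy KR z unfolding adj_complement by blast+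
        then have "adj (complement G) x y" using zR xy KR False unfolding simplicial_in_def by blast
        then show ?thesis by (simp add: adj_complement)
      qed
    qed
    have "t * real (card K) \<le> n - real (card K)"
    proof (rule labels_bound[of K "\<lambda>x. x"])
      show "K \<subseteq> verts G" using V unfolding K_def by blast
      show "2 \<le> card K" using \<open>3 \<le> card K\<close> by simp
    qed (use ind in auto)
    moreover have "t * 3 \<le> t * real (card K)" using \<open>3 \<le> card K\<close> t_pos by simp
    \<comment> \<open>\<open>t |K| \<le> n - |K| = (n - |X|) + 1 < 2 t + 1\<close>\<close>
    ultimately have "t * real (card K) < 2 * t + 1" using X(4) cX n by linarith
    then have "t * (real (card K) - 2) < 1" by (simp add: algebra_simps)
    moreover have "t * 1 \<le> t * (real (card K) - 2)" using \<open>3 \<le> card K\<close> t_pos by simp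
    ultimately have "t < 1" by linarith
    then have "card R < 2" using small by linarith
    moreover have "card K \<le> card R" using finR card_mono[of R K] unfolding K_def by simp
    ultimately show False using \<open>3 \<le> card K\<close> by linarith
  qed
qed

text \<open>Let \<open>q\<close> be the number of vertices outside the double star. From \<open>q < 2 t\<close> and \<open>t (|A| + 1) \<le> q + 1\<close>
  with \<open>q \<ge> 1\<close> and \<open>|A| \<ge> 2\<close> one gets \<open>t < 1\<close>, hence \<open>q = 1\<close>, and then \<open>|A| = 2\<close>. The single further vertex \<open>z\<close> is adjacent
  to every leaf, because a pendant leaf would give \<open>2 t \<le> 1\<close>. Adjacency of \<open>z\<close> to a leaf forces
  adjacency to the centre that does not see this leaf. If \<open>z\<close> were adjacent to \<open>u\<close>, the edge \<open>zu\<close> would be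
  dominating with the two common neighbours in \<open>A\<close>; so \<open>z\<close> is not adjacent to \<open>u\<close>, and \<open>B\<close> is empty.\<close>

lemma many_leaves:
  assumes ds: "double_star_at G u v A B" and AB: "2 \<le> card A"
    and s: "simplicial (complement G) u" "simplicial (complement G) v"
    and dom: "\<And>w. w \<in> verts G \<Longrightarrow> w \<noteq> u \<Longrightarrow> w \<noteq> v \<Longrightarrow> adj G u w \<or> adj G v w"
    and small: "n - (2 + real (card A) + real (card B)) < 2 * t"
    and R: "verts G \<noteq> insert u (insert v (A \<union> B))"
  obtains z where "verts G = insert z (insert u (insert v A))" "card A = 2" "z \<notin> A" "z \<noteq> u" "z \<noteq> v"
    "adj G v z" "\<not> adj G u z" "\<forall>a\<in>A. adj G z a" "B = {}"
proof -
  note d = double_star_at_distinct[OF simple ds]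
  let ?X = "insert u (insert v (A \<union> B))"
  have adjs: "adj G u v" "\<forall>a\<in>A. adj G u a \<and> \<not> adj G v a" "\<forall>b\<in>B. adj G v b \<and> \<not> adj G u b"
    "\<forall>x\<in>A\<union>B. \<forall>y\<in>A\<union>B. \<not> adj G x y"
    using ds unfolding double_star_at_def by auto
  have uvV: "u \<in> verts G" "v \<in> verts G" using adj_vertsD[OF simple adjs(1)] by auto
  have XV: "?X \<subseteq> verts G" using d(7,8) uvV by blast
  have cX: "card ?X = 2 + card A + card B" by (rule card_double_star_at[OF simple ds])
  define q where "q = card (verts G) - card ?X"
  have le: "card ?X \<le> card (verts G)" using card_mono[OF finite_verts XV] .
  have n: "n = real q + 2 + real (card A) + real (card B)" using cX le by (simp add: q_def)
  have "card ?X < card (verts G)" using R XV finite_verts by (intro psubset_card_mono) auto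
  then have q1: "q \<ge> 1" by (simp add: q_def)
  have qt: "real q < 2 * t" using small n by simp
  have "t * (real (card A) + 1) \<le> real q + 1" using double_star_bound[OF ds] AB n by (cases "A = {}") auto
  moreover have "t * 3 \<le> t * (real (card A) + 1)" using AB t_pos by simp
  ultimately have "q < 2" "t < 1" using qt by linarith+
  then have q: "q = 1" using q1 by simp
  have tA: "t * (real (card A) + 1) \<le> 2" using \<open>t * (real (card A) + 1) \<le> real q + 1\<close> q by simp
  have "card A = 2"
  proof (rule ccontr)
    assume "card A \<noteq> 2"
    then have "t * 4 \<le> t * (real (card A) + 1)" using AB t_pos by simp
    then show False using tA qt q by linarith
  qed
  have "card (verts G - ?X) = 1" using card_Diff_subset[of ?X "verts G"] XV finite_verts q
    by (metis finite_subset q_def)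
  then obtain z where z: "verts G - ?X = {z}" using card_1_singletonE by blast
  then have V: "verts G = insert z ?X" and zX: "z \<notin> ?X" using XV by blast+
  have leaf: "adj G z l" if l: "l \<in> A \<union> B" for l
  proof (rule ccontr)
    assume nl: "\<not> adj G z l"
    \<comment> \<open>Deleting the centre \<open>c\<close> of the leaf \<open>l\<close> would isolate \<open>l\<close>.\<close>
    define c where "c = (if l \<in> A then u else v)"
    define c' where "c' = (if l \<in> A then v else u)"
    have cc: "c \<in> verts G" "c' \<in> verts G" "c' \<noteq> c" "c' \<noteq> l" "l \<noteq> c" "l \<in> verts G"
      using uvV d l unfolding c_def c'_def by auto
    have ns: "\<not> adj G l w" if w: "w \<in> verts G - {c}" for w
    proof -
      have "w = z \<or> w = c' \<or> w \<in> A \<union> B" using w V unfolding c_def c'_def by auto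
      moreover have "\<not> adj G c' l" using l adjs unfolding c'_def by auto
      ultimately show ?thesis using nl l adjs(4) sym by blast
    qed
    have "2 * t \<le> n - real (card (verts G - {c}))"
      by (rule isolated_bound[of _ l c']) (use cc ns in auto)
    moreover have "real (card (verts G - {c})) = n - 1"
      using card_Suc_Diff1[OF finite_verts cc(1)] by linarith
    ultimately show False using qt q by simp
  qed
  obtain a a' where aa: "a \<in> A" "a' \<in> A" "a \<noteq> a'"
  proof -
    have "finite A" using d(7) finite_verts finite_subset by blast
    then have "\<not> (\<forall>x\<in>A. \<forall>y\<in>A. x = y)" using AB card_le_Suc0_iff_eq[of A] by simp
    then show thesis using that by blast
  qed
  have zne: "z \<noteq> u" "z \<noteq> v" "z \<in> verts G" using V zX by auto
  have zv: "adj G v z"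
    using cosimplicial_nonneighbours[OF s(2), of a z] adjs(2) aa d(3,7) zne simple leaf[of a] sym[of a z] by blast
  have nzu: "\<not> adj G z u"
  proof
    assume zu: "adj G z u"
    show False
    proof (rule common_neighbours_impossible[OF zu, of a a'])
      fix w assume "w \<in> verts G" "w \<noteq> z" "w \<noteq> u"
      then have "w = v \<or> w \<in> A \<union> B" using V by blast
      then show "adj G z w \<or> adj G u w" using leaf adjs(1) by blast
    qed (use leaf aa adjs(2) \<open>t < 1\<close> in auto)
  qed
  have "B = {}"
  proof (rule ccontr)
    assume "B \<noteq> {}"
    then obtain b where b: "b \<in> B" by blast
    have "adj G u z"
      using cosimplicial_nonneighbours[OF s(1), of b z] adjs(3) b d(4,8) zne simple leaf[of b] sym[of b z] by blast
    then show False using nzu sym by blast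
  qed
  show thesis
    by (rule that[of z]) (use V zX \<open>card A = 2\<close> zne zv nzu sym leaf \<open>B = {}\<close> in auto)
qed

text \<open>The three alternatives are the double stars, the complete multipartite graphs and \<open>K\<^bsub>2,3\<^esub>\<close> with parts
  \<open>{u, z}\<close> and \<open>{v} \<union> A\<close>.\<close>

lemma bigger_side_classification:
  assumes ds: "double_star_at G u v A B" and le: "card B \<le> card A"
    and s: "simplicial (complement G) u" "simplicial (complement G) v" and chordal: "chordal (complement G)"
    and dom: "\<And>w. w \<in> verts G \<Longrightarrow> w \<noteq> u \<Longrightarrow> w \<noteq> v \<Longrightarrow> adj G u w \<or> adj G v w"
    and small: "n - (2 + real (card A) + real (card B)) < 2 * t"
    and nc: "x0 \<in> verts G" "y0 \<in> verts G" "x0 \<noteq> y0" "\<not> adj G x0 y0"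
  shows "verts G = insert u (insert v (A \<union> B)) \<and> A \<noteq> {} \<or> n - 3 < 2 * t \<or>
    (\<exists>z. verts G = insert z (insert u (insert v A)) \<and> card A = 2 \<and> z \<notin> A \<and> z \<noteq> u \<and> z \<noteq> v \<and>
        adj G v z \<and> \<not> adj G u z \<and> (\<forall>a\<in>A. adj G z a) \<and> B = {})"
proof -
  note d = double_star_at_distinct[OF simple ds]
  have fin: "finite A" "finite B" using d(7,8) finite_verts finite_subset by blast+
  have uvV: "u \<in> verts G" "v \<in> verts G"
    using ds adj_vertsD[OF simple, of u v] unfolding double_star_at_def by auto
  have cA: "card A \<noteq> 0"
    using small le nonadjacent_bound[OF nc] by auto
  consider "2 \<le> card A" | "card A = 1" "card B = 0" | "card A = 1" "card B = 1"
    using cA le by linarith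
  then show ?thesis
  proof cases
    case 1
    show ?thesis
    proof (cases "verts G = insert u (insert v (A \<union> B))")
      case False
      obtain z where "verts G = insert z (insert u (insert v A))" "card A = 2" "z \<notin> A" "z \<noteq> u" "z \<noteq> v"
        "adj G v z" "\<not> adj G u z" "\<forall>a\<in>A. adj G z a" "B = {}"
        by (rule many_leaves[OF ds 1 s dom small False])
      then show ?thesis by blast
    qed (use cA in auto)
  next
    case 2
    then show ?thesis using small by simp
  next
    case 3
    obtain a b where ab: "A = {a}" "B = {b}" using 3 by (metis card_1_singletonE)
    define R where "R = verts G - {u, v, a, b}"
    have V: "verts G = R \<union> {u, v, a, b}" using uvV d(7,8) unfolding R_def ab by blast
    show ?thesis
    proof (cases "R = {}")
      case True
      then show ?thesis using V ab by auto
    next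
      case False
      have fR: "finite R" using finite_verts by (simp add: R_def)
      have "u \<noteq> a" "u \<noteq> b" "v \<noteq> a" "v \<noteq> b" "a \<noteq> b" using d(2-6) unfolding ab by simp_all
      then have "card {u, v, a, b} = 4" using d(1) by simp
      moreover have disj: "R \<inter> {u, v, a, b} = {}" by (auto simp: R_def)
      ultimately have "card (verts G) = card R + 4"
        using card_Un_disjoint[OF fR _ disj] unfolding V by simp
      then have "real (card R) < 2 * t" using small 3 by simp
      then have False
        using one_leaf_each_impossible[OF ds[unfolded ab] False disj V s chordal] by blast
      then show ?thesis ..
    qed
  qed
qed

end

section \<open>Recognising the listed graphs up to isomorphism\<close>

lemma graph_iso_sym:
  assumes "G \<simeq>\<^sub>g H"
  shows "H \<simeq>\<^sub>g G"
proof -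
  obtain f where f: "bij_betw f (verts G) (verts H)"
    "\<forall>u\<in>verts G. \<forall>v\<in>verts G. adj G u v \<longleftrightarrow> adj H (f u) (f v)"
    using assms unfolding graph_iso_def by blast
  let ?g = "inv_into (verts G) f"
  have g: "bij_betw ?g (verts H) (verts G)" using f(1) by (rule bij_betw_inv_into)
  moreover have "adj H u v \<longleftrightarrow> adj G (?g u) (?g v)" if "u \<in> verts H" "v \<in> verts H" for u v
  proof -
    have "?g u \<in> verts G" "?g v \<in> verts G" using g that bij_betwE by blast+
    moreover have "f (?g u) = u" "f (?g v) = v"
      using f(1) that by (simp_all add: bij_betw_inv_into_right)
    ultimately show ?thesis using f(2) by metis
  qed
  ultimately show ?thesis unfolding graph_iso_def by blast
qed

lemma double_star_at_image:
  assumes f: "bij_betw f (verts G) (verts H)"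
      "\<forall>x\<in>verts G. \<forall>y\<in>verts G. adj G x y \<longleftrightarrow> adj H (f x) (f y)"
    and ds: "double_star_at G u v A B" and V: "verts G = insert u (insert v (A \<union> B))"
  shows "double_star_at H (f u) (f v) (f ` A) (f ` B)"
    "verts H = insert (f u) (insert (f v) (f ` A \<union> f ` B))"
    "card (f ` A) = card A" "card (f ` B) = card B"
proof -
  have inj: "inj_on f (verts G)" and im: "f ` verts G = verts H"
    using f(1) by (simp_all add: bij_betw_def)
  have sub: "A \<subseteq> verts G" "B \<subseteq> verts G" "u \<in> verts G" "v \<in> verts G" using V by blast+
  show "verts H = insert (f u) (insert (f v) (f ` A \<union> f ` B))"
    unfolding im[symmetric] V by (simp add: image_Un)
  show "card (f ` A) = card A" "card (f ` B) = card B"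
    using card_image[OF inj_on_subset[OF inj sub(1)]] card_image[OF inj_on_subset[OF inj sub(2)]]
    by simp_all
  have adjs: "adj G u v" "v \<notin> A" "u \<notin> B" "\<And>a. a \<in> A \<Longrightarrow> adj G u a \<and> \<not> adj G v a"
    "\<And>b. b \<in> B \<Longrightarrow> adj G v b \<and> \<not> adj G u b" "\<And>x y. x \<in> A \<union> B \<Longrightarrow> y \<in> A \<union> B \<Longrightarrow> \<not> adj G x y"
    using ds unfolding double_star_at_def by blast+
  have tr: "adj H (f x) (f y) \<longleftrightarrow> adj G x y" if "x \<in> verts G" "y \<in> verts G" for x y
    using f(2) that by blast
  show "double_star_at H (f u) (f v) (f ` A) (f ` B)"
    unfolding double_star_at_def image_Un[symmetric]
  proof (intro conjI ballI)
    show "adj H (f u) (f v)" using tr adjs(1) sub by blast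
    show "f v \<notin> f ` A" "f u \<notin> f ` B"
      using adjs(2,3) inj_on_image_mem_iff[OF inj] sub by blast+
  next
    fix a assume "a \<in> f ` A"
    then obtain x where "x \<in> A" "a = f x" by blast
    then show "adj H (f u) a" "\<not> adj H (f v) a" using adjs(4)[of x] tr[of u x] tr[of v x] sub by blast+
  next
    fix b assume "b \<in> f ` B"
    then obtain x where "x \<in> B" "b = f x" by blast
    then show "adj H (f v) b" "\<not> adj H (f u) b" using adjs(5)[of x] tr[of u x] tr[of v x] sub by blast+
  next
    fix p q assume "p \<in> f ` (A \<union> B)" "q \<in> f ` (A \<union> B)"
    then obtain x y where "x \<in> A \<union> B" "p = f x" "y \<in> A \<union> B" "q = f y" by blast
    then show "\<not> adj H p q" using adjs(6)[of x y] tr[of x y] sub by blast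
  qed
qed

lemma adj_double_star_at:
  assumes G: "simple_graph G" and ds: "double_star_at G u v A B"
    and xy: "x \<in> insert u (insert v (A \<union> B))" "y \<in> insert u (insert v (A \<union> B))"
  shows "adj G x y \<longleftrightarrow> (x = u \<and> y = v) \<or> (x = v \<and> y = u) \<or> (x = u \<and> y \<in> A) \<or> (x \<in> A \<and> y = u) \<or>
     (x = v \<and> y \<in> B) \<or> (x \<in> B \<and> y = v)"
proof -
  have s: "adj G p q \<longleftrightarrow> adj G q p" for p q by (simp add: insert_commute)
  have i: "\<not> adj G p p" for p using adj_vertsD(3)[OF G, of p p] by blast
  note d = double_star_at_distinct[OF G ds]
  have e: "adj G u v" "\<And>a. a \<in> A \<Longrightarrow> adj G u a \<and> \<not> adj G v a" "\<And>b. b \<in> B \<Longrightarrow> adj G v b \<and> \<not> adj G u b"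
    "\<And>p q. p \<in> A \<union> B \<Longrightarrow> q \<in> A \<union> B \<Longrightarrow> \<not> adj G p q"
    using ds unfolding double_star_at_def by blast+
  consider "x = u" | "x = v" | "x \<in> A" | "x \<in> B" using xy(1) by blast
  then show ?thesis
  proof cases
    case 1
    have "adj G u y \<longleftrightarrow> y = v \<or> y \<in> A" using xy(2) e(1) e(2)[of y] e(3)[of y] i by blast
    then show ?thesis unfolding 1 using d by blast
  next
    case 2
    have "adj G v y \<longleftrightarrow> y = u \<or> y \<in> B" using xy(2) e(1) e(2)[of y] e(3)[of y] i s[of u v] by blast
    then show ?thesis unfolding 2 using d by blast
  next
    case 3
    have "adj G x y \<longleftrightarrow> y = u" using xy(2) 3 e(2)[of x] e(4)[of x y] s[of x u] s[of x v] by blast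
    then show ?thesis using 3 d by blast
  next
    case 4
    have "adj G x y \<longleftrightarrow> y = v" using xy(2) 4 e(3)[of x] e(4)[of x y] s[of x u] s[of x v] by blast
    then show ?thesis using 4 d by blast
  qed
qed

lemma double_star_at_iso:
  assumes G: "simple_graph G" "double_star_at G u v A B" "verts G = insert u (insert v (A \<union> B))"
    and H: "simple_graph H" "double_star_at H u' v' A' B'" "verts H = insert u' (insert v' (A' \<union> B'))"
    and c: "card A = card A'" "card B = card B'"
  shows "G \<simeq>\<^sub>g H"
proof -
  note d = double_star_at_distinct[OF G(1,2)] and d' = double_star_at_distinct[OF H(1,2)]
  have "finite A" "finite A'" "finite B" "finite B'"
    using d(7,8) d'(7,8) G(1) H(1) finite_subset by (auto simp: simple_graph_def)
  then obtain g h where g: "bij_betw g A A'" and h: "bij_betw h B B'"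
    using c by (meson finite_same_card_bij)
  define f where "f x = (if x = u then u' else if x = v then v' else if x \<in> A then g x else h x)" for x
  have fu: "f u = u'" "f v = v'" using d by (auto simp: f_def)
  have fA: "bij_betw f A A'" 
    by (rule bij_betw_cong[THEN iffD1, OF _ g]) (use d in \<open>auto simp: f_def\<close>)
  have fB: "bij_betw f B B'" 
    by (rule bij_betw_cong[THEN iffD1, OF _ h]) (use d in \<open>auto simp: f_def\<close>)
  have "bij_betw f (A \<union> B) (A' \<union> B')" by (rule bij_betw_combine[OF fA fB d'(6)])
  moreover have "bij_betw f {v} {v'}" "bij_betw f {u} {u'}" using fu by simp_all
  ultimately have "bij_betw f ({u} \<union> ({v} \<union> (A \<union> B))) ({u'} \<union> ({v'} \<union> (A' \<union> B')))"
    using d' bij_betw_combine[of f "{v}" "{v'}" "A \<union> B" "A' \<union> B'"]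
      bij_betw_combine[of f "{u}" "{u'}" "{v} \<union> (A \<union> B)" "{v'} \<union> (A' \<union> B')"] by blast
  then have bij: "bij_betw f (verts G) (verts H)" using G(3) H(3) by (simp add: insert_commute)
  have mem: "f x \<in> verts H" "f x \<in> A' \<longleftrightarrow> x \<in> A" "f x \<in> B' \<longleftrightarrow> x \<in> B" "f x = u' \<longleftrightarrow> x = u" "f x = v' \<longleftrightarrow> x = v"
    if x: "x \<in> verts G" for x
  proof -
    have im: "f ` A = A'" "f ` B = B'" using fA fB by (simp_all add: bij_betw_def)
    have inj: "inj_on f (verts G)" using bij by (simp add: bij_betw_def)
    have uv: "u \<in> verts G" "v \<in> verts G" using G(3) by blast+
    show "f x \<in> verts H" using bij x bij_betwE by blast
    show "f x \<in> A' \<longleftrightarrow> x \<in> A" "f x \<in> B' \<longleftrightarrow> x \<in> B"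
      using inj_on_image_mem_iff[OF inj x d(7)] inj_on_image_mem_iff[OF inj x d(8)] im by simp_all
    show "f x = u' \<longleftrightarrow> x = u" "f x = v' \<longleftrightarrow> x = v"
      using inj_on_eq_iff[OF inj x uv(1)] inj_on_eq_iff[OF inj x uv(2)] fu by simp_all
  qed
  have "adj G x y \<longleftrightarrow> adj H (f x) (f y)" if xy: "x \<in> verts G" "y \<in> verts G" for x y
    unfolding adj_double_star_at[OF G(1,2) xy[unfolded G(3)]]
      adj_double_star_at[OF H(1,2) mem(1)[OF xy(1), unfolded H(3)] mem(1)[OF xy(2), unfolded H(3)]]
      mem(2-)[OF xy(1)] mem(2-)[OF xy(2)] ..
  then show ?thesis using bij unfolding graph_iso_def by blast
qed

text \<open>With this criterion, recognising \<open>P\<^sub>4\<close>, a star or a double star only requires exhibiting the structure in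
  the concrete graph.\<close>

lemma double_star_at_transfer:
  assumes G: "simple_graph G" and H: "simple_graph H" "double_star_at H u v A B" "verts H = insert u (insert v (A \<union> B))"
  shows "G \<simeq>\<^sub>g H \<longleftrightarrow> (\<exists>u' v' A' B'. double_star_at G u' v' A' B' \<and> verts G = insert u' (insert v' (A' \<union> B')) \<and>
     card A' = card A \<and> card B' = card B)"
proof
  assume "G \<simeq>\<^sub>g H"
  then have "H \<simeq>\<^sub>g G" by (rule graph_iso_sym)
  then obtain f where "bij_betw f (verts H) (verts G)"
      "\<forall>x\<in>verts H. \<forall>y\<in>verts H. adj H x y \<longleftrightarrow> adj G (f x) (f y)"
    unfolding graph_iso_def by blast
  from double_star_at_image[OF this H(2,3)]
  show "\<exists>u' v' A' B'. double_star_at G u' v' A' B' \<and> verts G = insert u' (insert v' (A' \<union> B')) \<and>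
     card A' = card A \<and> card B' = card B" by blast
next
  assume "\<exists>u' v' A' B'. double_star_at G u' v' A' B' \<and> verts G = insert u' (insert v' (A' \<union> B')) \<and>
     card A' = card A \<and> card B' = card B"
  then show "G \<simeq>\<^sub>g H" using double_star_at_iso[OF G _ _ H] by blast
qed

lemma simple_path_graph: "simple_graph (path_graph n)"
  by (auto simp: simple_graph_def path_graph_def)

lemma path_graph_4_double_star:
  "double_star_at (path_graph 4) 1 2 {0} {3}" "verts (path_graph 4) = insert 1 (insert 2 ({0} \<union> {3}))"
proof -
  have e: "edges (path_graph 4) = {{0, 1}, {1, 2}, {2, 3}}"
  proof -
    have "{i. Suc i < 4} = {0, 1, 2}" by auto
    moreover have "{{i, Suc i} | i. Suc i < 4} = (\<lambda>i. {i, Suc i}) ` {i. Suc i < 4}" by blast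
    ultimately have "{{i, Suc i} | i. Suc i < 4} = (\<lambda>i. {i, Suc i}) ` {0, 1, 2}" by simp
    also have "\<dots> = {{0, 1}, {1, 2}, {2, 3}}" by (simp add: numeral_2_eq_2 numeral_3_eq_3)
    finally show ?thesis unfolding path_graph_def snd_conv .
  qed
  show "double_star_at (path_graph 4) 1 2 {0} {3}"
    unfolding double_star_at_def e by (simp add: doubleton_eq_iff)
  show "verts (path_graph 4) = insert 1 (insert 2 ({0} \<union> {3}))"
    by (auto simp: path_graph_def)
qed

lemma simple_complete_bipartite: "simple_graph (complete_bipartite m n)"
  by (auto simp: simple_graph_def complete_bipartite_def)

lemma adj_complete_bipartite:
  "adj (complete_bipartite m n) x y \<longleftrightarrow>
     (\<exists>i<m. \<exists>j<n. x = Inl i \<and> y = Inr j \<or> x = Inr j \<and> y = Inl i)"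
  unfolding complete_bipartite_def snd_conv by (auto simp: doubleton_eq_iff)

text \<open>One leaf of the star serves as the second centre, which then has no leaves of its own.\<close>

lemma star_double_star:
  assumes "l \<ge> 1"
  shows "double_star_at (star l) (Inl 0) (Inr 0) (Inr ` {1..<l}) {}"
    "verts (star l) = insert (Inl 0) (insert (Inr 0) (Inr ` {1..<l} \<union> {}))"
proof -
  show "double_star_at (star l) (Inl 0) (Inr 0) (Inr ` {1..<l}) {}"
    using assms unfolding double_star_at_def adj_complete_bipartite by auto
  have "{..<l} = insert 0 {1..<l}" using assms by auto
  then show "verts (star l) = insert (Inl 0) (insert (Inr 0) (Inr ` {1..<l} \<union> {}))"
    by (auto simp: complete_bipartite_def)
qed

lemma double_star_double_star:
  shows "simple_graph (double_star k l)"
    "double_star_at (double_star k l) (Inl (Inl 0)) (Inr (Inl 0)) (Inl ` Inr ` {..<k}) (Inr ` Inr ` {..<l})"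
    "verts (double_star k l) = insert (Inl (Inl 0)) (insert (Inr (Inl 0)) (Inl ` Inr ` {..<k} \<union> Inr ` Inr ` {..<l}))"
proof -
  have e: "edges (double_star k l) = insert {Inl (Inl 0), Inr (Inl 0)}
      ({{Inl (Inl 0), Inl (Inr i)} | i. i < k} \<union> {{Inr (Inl 0), Inr (Inr i)} | i. i < l})"
  proof -
    have im: "(`) c ` {{Inl 0, Inr j} | j. j < m} = {{c (Inl 0), c (Inr j)} | j. j < m}"
      for c :: "nat + nat \<Rightarrow> (nat + nat) + (nat + nat)" and m
    proof -
      have "(`) c ` {{Inl 0, Inr j} | j. j < m} = {c ` {Inl 0, Inr j} | j. j < m}" by blast
      then show ?thesis by simp
    qed
    have "edges (star m) = {{Inl 0, Inr j} | j. j < m}" for m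
      by (auto simp: complete_bipartite_def)
    then show ?thesis unfolding double_star_def disjoint_union_def Let_def by (simp add: im)
  qed
  show V: "verts (double_star k l) = insert (Inl (Inl 0)) (insert (Inr (Inl 0)) (Inl ` Inr ` {..<k} \<union> Inr ` Inr ` {..<l}))"
    unfolding double_star_def disjoint_union_def complete_bipartite_def Let_def by auto
  show "simple_graph (double_star k l)"
    unfolding simple_graph_def V e by auto
  show "double_star_at (double_star k l) (Inl (Inl 0)) (Inr (Inl 0)) (Inl ` Inr ` {..<k}) (Inr ` Inr ` {..<l})"
    unfolding double_star_at_def e by (auto simp: doubleton_eq_iff)
qed

definition bipartition :: "'a ugraph \<Rightarrow> 'a set \<Rightarrow> 'a set \<Rightarrow> bool" where
  "bipartition G A B \<longleftrightarrow> verts G = A \<union> B \<and> A \<inter> B = {} \<and>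
     (\<forall>x\<in>verts G. \<forall>y\<in>verts G. adj G x y \<longleftrightarrow> (x \<in> A \<and> y \<in> B) \<or> (x \<in> B \<and> y \<in> A))"

lemma iso_complete_bipartite_iff:
  assumes "finite (verts G)"
  shows "G \<simeq>\<^sub>g complete_bipartite m n \<longleftrightarrow> (\<exists>A B. bipartition G A B \<and> card A = m \<and> card B = n)"
proof
  assume "G \<simeq>\<^sub>g complete_bipartite m n"
  then have "complete_bipartite m n \<simeq>\<^sub>g G" by (rule graph_iso_sym)
  then obtain f where f: "bij_betw f (verts (complete_bipartite m n)) (verts G)"
      "\<forall>x\<in>verts (complete_bipartite m n). \<forall>y\<in>verts (complete_bipartite m n).
        adj (complete_bipartite m n) x y \<longleftrightarrow> adj G (f x) (f y)"
    unfolding graph_iso_def by blast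
  let ?L = "Inl ` {..<m} :: (nat + nat) set" and ?R = "Inr ` {..<n} :: (nat + nat) set"
  have V: "verts (complete_bipartite m n) = ?L \<union> ?R" by (simp add: complete_bipartite_def)
  have inj: "inj_on f (?L \<union> ?R)" and im: "f ` (?L \<union> ?R) = verts G" using f(1) V by (simp_all add: bij_betw_def)
  have mem: "f x \<in> f ` ?L \<longleftrightarrow> x \<in> ?L" "f x \<in> f ` ?R \<longleftrightarrow> x \<in> ?R" if "x \<in> ?L \<union> ?R" for x
    using inj_on_image_mem_iff[OF inj that] by blast+
  have "bipartition G (f ` ?L) (f ` ?R)"
    unfolding bipartition_def
  proof (intro conjI ballI)
    show "verts G = f ` ?L \<union> f ` ?R" using im by (simp add: image_Un)
    show "f ` ?L \<inter> f ` ?R = {}" using mem by blast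
    fix x' y' assume "x' \<in> verts G" "y' \<in> verts G"
    then obtain x y where x: "x \<in> ?L \<union> ?R" "x' = f x" and y: "y \<in> ?L \<union> ?R" "y' = f y"
      unfolding im[symmetric] by blast
    have "adj G (f x) (f y) \<longleftrightarrow> adj (complete_bipartite m n) x y" using f(2) x(1) y(1) V by simp
    also have "\<dots> \<longleftrightarrow> (x \<in> ?L \<and> y \<in> ?R) \<or> (x \<in> ?R \<and> y \<in> ?L)"
      unfolding adj_complete_bipartite by auto
    finally show "adj G x' y' \<longleftrightarrow> (x' \<in> f ` ?L \<and> y' \<in> f ` ?R) \<or> (x' \<in> f ` ?R \<and> y' \<in> f ` ?L)"
      unfolding x(2) y(2) mem[OF x(1)] mem[OF y(1)] .
  qed
  moreover have "card (f ` ?L) = m" "card (f ` ?R) = n"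
  proof -
    have "inj_on f ?L" "inj_on f ?R" using inj_on_subset[OF inj] by simp_all
    then show "card (f ` ?L) = m" "card (f ` ?R) = n" by (simp_all add: card_image)
  qed
  ultimately show "\<exists>A B. bipartition G A B \<and> card A = m \<and> card B = n" by blast
next
  assume "\<exists>A B. bipartition G A B \<and> card A = m \<and> card B = n"
  then obtain A B where AB: "bipartition G A B" "card A = m" "card B = n" by blast
  then have V: "verts G = A \<union> B" and disj: "A \<inter> B = {}" by (simp_all add: bipartition_def)
  have "finite A" "finite B" using V assms by simp_all
  then obtain g h where g: "bij_betw g A {..<m}" and h: "bij_betw h B {..<n}"
    using AB(2,3) by (metis atLeast0LessThan ex_bij_betw_finite_nat)
  define f where "f x = (if x \<in> A then Inl (g x) else Inr (h x))" for x
  have "bij_betw (Inl \<circ> g) A (Inl ` {..<m})" "bij_betw (Inr \<circ> h) B (Inr ` {..<n})"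
    by (rule bij_betw_trans[OF g] bij_betw_trans[OF h], simp add: bij_betw_def)+
  moreover have "f x = (Inl \<circ> g) x" if "x \<in> A" for x using that by (simp add: f_def)
  moreover have "f x = (Inr \<circ> h) x" if "x \<in> B" for x using that disj by (auto simp: f_def)
  ultimately have fA: "bij_betw f A (Inl ` {..<m})" and fB: "bij_betw f B (Inr ` {..<n})"
    by (metis (no_types, lifting) bij_betw_cong)+
  have "bij_betw f (A \<union> B) (Inl ` {..<m} \<union> Inr ` {..<n})"
    by (rule bij_betw_combine[OF fA fB]) auto
  then have "bij_betw f (verts G) (verts (complete_bipartite m n))"
    using V by (simp add: complete_bipartite_def)
  moreover have "adj G x y \<longleftrightarrow> adj (complete_bipartite m n) (f x) (f y)" if "x \<in> verts G" "y \<in> verts G" for x y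
  proof -
    have lt: "g z < m" if "z \<in> A" for z using g that bij_betwE by fastforce
    have lt': "h z < n" if "z \<in> B" for z using h that bij_betwE by fastforce
    have B: "z \<in> B \<longleftrightarrow> z \<notin> A" if "z \<in> verts G" for z using that V disj by blast
    have "adj G x y \<longleftrightarrow> (x \<in> A \<and> y \<in> B) \<or> (x \<in> B \<and> y \<in> A)"
      using AB(1) that unfolding bipartition_def by blast
    then show ?thesis
      unfolding adj_complete_bipartite f_def using B[OF that(1)] B[OF that(2)] lt[of x] lt[of y] lt'[of x] lt'[of y]
      by auto
  qed
  ultimately show "G \<simeq>\<^sub>g complete_bipartite m n" unfolding graph_iso_def by blast
qed

lemma nonadjacency_matching_remove_pair:
  assumes M: "nonadjacency_matching E V" and sym: "\<And>x y. E x y \<longleftrightarrow> E y x"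
    and v: "v \<in> V" "w \<in> V" "v \<noteq> w" "\<not> E v w"
  shows "nonadjacency_matching E (V - {v, w})" "\<And>x. x \<in> V - {v, w} \<Longrightarrow> E x v \<and> E x w"
proof -
  have uniq: "\<And>v x y. v \<in> V \<Longrightarrow> x \<in> V - {v} \<Longrightarrow> y \<in> V - {v} \<Longrightarrow> \<not> E v x \<Longrightarrow> \<not> E v y \<Longrightarrow> x = y"
    and univ: "\<And>x y. x \<in> V \<Longrightarrow> y \<in> V \<Longrightarrow> \<forall>z\<in>V - {x}. E x z \<Longrightarrow> \<forall>z\<in>V - {y}. E y z \<Longrightarrow> x = y"
    using M unfolding nonadjacency_matching_def by blast+
  show adj: "E x v \<and> E x w" if x: "x \<in> V - {v, w}" for x
    using uniq[of v x w] uniq[of w x v] x v sym by blast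
  show "nonadjacency_matching E (V - {v, w})"
    unfolding nonadjacency_matching_def
  proof (intro conjI ballI impI)
    fix p x y assume "p \<in> V - {v, w}" "x \<in> V - {v, w} - {p}" "y \<in> V - {v, w} - {p}" "\<not> E p x \<and> \<not> E p y"
    then show "x = y" using uniq[of p x y] by blast
  next
    fix x y assume xy: "x \<in> V - {v, w}" "y \<in> V - {v, w}"
      and all: "(\<forall>z\<in>V - {v, w} - {x}. E x z) \<and> (\<forall>z\<in>V - {v, w} - {y}. E y z)"
    have "\<forall>z\<in>V - {x}. E x z" "\<forall>z\<in>V - {y}. E y z" using all adj[OF xy(1)] adj[OF xy(2)] by blast+
    then show "x = y" using univ[of x y] xy by blast
  qed
qed

lemma nonadjacency_matching_pair:
  assumes "nonadjacency_matching E V" "2 \<le> card V"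
  obtains v w where "v \<in> V" "w \<in> V" "v \<noteq> w" "\<not> E v w"
proof -
  have "\<not> (\<exists>x. V \<subseteq> {x})" using assms(2) card_mono[of "{x}" V for x] by fastforce
  then obtain x y where "x \<in> V" "y \<in> V" "x \<noteq> y" by blast
  then show thesis using assms(1) that unfolding nonadjacency_matching_def by blast
qed

text \<open>Match one non-adjacent pair of \<open>V\<close> with one of \<open>W\<close>; each vertex of such a pair is adjacent to all vertices
  outside it, so any isomorphism of the rest extends.\<close>

lemma nonadjacency_matching_iso:
  assumes "finite V" "finite W" "card V = card W"
    and "nonadjacency_matching E V" "nonadjacency_matching F W"
    and E: "\<And>x y. E x y \<longleftrightarrow> E y x" "\<And>x. \<not> E x x" and F: "\<And>x y. F x y \<longleftrightarrow> F y x" "\<And>x. \<not> F x x"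
  shows "\<exists>f. bij_betw f V W \<and> (\<forall>x\<in>V. \<forall>y\<in>V. E x y \<longleftrightarrow> F (f x) (f y))"
  using assms(1-5)
proof (induction "card V" arbitrary: V W rule: less_induct)
  case less
  show ?case
  proof (cases "card V \<le> 1")
    case True
    obtain f where f: "bij_betw f V W" using less.prems(1-3) finite_same_card_bij by blast
    have "x = y" if "x \<in> V" "y \<in> V" for x y
      using True less.prems(1) that by (simp add: card_le_Suc0_iff_eq)
    then show ?thesis using f E(2) F(2) by metis
  next
    case False
    obtain v v' where v: "v \<in> V" "v' \<in> V" "v \<noteq> v'" "\<not> E v v'"
      using nonadjacency_matching_pair[OF less.prems(4)] False by auto
    obtain w w' where w: "w \<in> W" "w' \<in> W" "w \<noteq> w'" "\<not> F w w'"
      using nonadjacency_matching_pair[OF less.prems(5)] False less.prems(3) by auto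
    note rV = nonadjacency_matching_remove_pair[OF less.prems(4) E(1) v]
    note rW = nonadjacency_matching_remove_pair[OF less.prems(5) F(1) w]
    have cV: "card (V - {v, v'}) = card V - 2" using v less.prems(1) by (simp add: card_Diff_subset)
    have cW: "card (W - {w, w'}) = card W - 2" using w less.prems(2) by (simp add: card_Diff_subset)
    have "\<exists>f. bij_betw f (V - {v, v'}) (W - {w, w'}) \<and>
        (\<forall>x\<in>V - {v, v'}. \<forall>y\<in>V - {v, v'}. E x y \<longleftrightarrow> F (f x) (f y))"
      by (rule less.hyps) (use False less.prems(1-3) cV cW rV(1) rW(1) in auto)
    then obtain f where f: "bij_betw f (V - {v, v'}) (W - {w, w'})"
        "\<forall>x\<in>V - {v, v'}. \<forall>y\<in>V - {v, v'}. E x y \<longleftrightarrow> F (f x) (f y)" by blast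
    define g where "g = f(v := w, v' := w')"
    have g1: "bij_betw g (V - {v, v'}) (W - {w, w'})"
      by (rule bij_betw_cong[THEN iffD1, OF _ f(1)]) (auto simp: g_def)
    have g2: "bij_betw g {v, v'} {w, w'}"
      using v(3) w(3) by (auto simp: g_def bij_betw_def)
    have "bij_betw g ((V - {v, v'}) \<union> {v, v'}) ((W - {w, w'}) \<union> {w, w'})"
      by (rule bij_betw_combine[OF g1 g2]) auto
    moreover have "(V - {v, v'}) \<union> {v, v'} = V" "(W - {w, w'}) \<union> {w, w'} = W" using v w by auto
    ultimately have bij: "bij_betw g V W" by simp
    have "E x y \<longleftrightarrow> F (g x) (g y)" if xy: "x \<in> V" "y \<in> V" for x y
    proof -
      have gv: "g v = w" "g v' = w'" using v(3) by (simp_all add: g_def)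
      have gW: "g z \<in> W - {w, w'}" if "z \<in> V - {v, v'}" for z using g1 that bij_betwE by blast
      consider "x \<in> V - {v, v'}" "y \<in> V - {v, v'}" | "x \<in> V - {v, v'}" "y \<in> {v, v'}"
        | "x \<in> {v, v'}" "y \<in> V - {v, v'}" | "x \<in> {v, v'}" "y \<in> {v, v'}" using xy by blast
      then show ?thesis
      proof cases
        case 1
        then have "g x = f x" "g y = f y" by (auto simp: g_def)
        then show ?thesis using f(2) 1 by simp
      next
        case 2
        then show ?thesis using rV(2)[OF 2(1)] rW(2)[OF gW[OF 2(1)]] gv by auto
      next
        case 3
        then show ?thesis using rV(2)[OF 3(2)] rW(2)[OF gW[OF 3(2)]] gv E(1) F(1) by blast
      next
        case 4
        then show ?thesis using gv v(4) w(4) E F by (elim insertE emptyE) auto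
      qed
    qed
    then show ?thesis using bij by blast
  qed
qed

lemma adj_turan_graph: "adj (turan_graph n k) i j \<longleftrightarrow> i < n \<and> j < n \<and> i mod k \<noteq> j mod k"
  unfolding turan_graph_def snd_conv by (auto simp: doubleton_eq_iff)

text \<open>Residue classes modulo \<open>l\<close> are \<open>{i, i + l}\<close>, except that \<open>l - 1\<close> is alone in its class if \<open>n = 2 * l - 1\<close>.\<close>

lemma turan_graph_nonadjacency_matching:
  assumes n: "n = 2 * l \<or> n = 2 * l - 1" and l: "1 \<le> l"
  shows "nonadjacency_matching (adj (turan_graph n l)) (verts (turan_graph n l))"
proof -
  have V: "verts (turan_graph n l) = {..<n}" by (simp add: turan_graph_def)
  have m: "i mod l = (if i < l then i else i - l)" if "i < n" for i
    using that n l by (auto simp: le_mod_geq)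
  have non: "\<not> adj (turan_graph n l) i j \<longleftrightarrow> j = i + l \<or> i = j + l" if "i < n" "j < n" "i \<noteq> j" for i j
  proof -
    have "\<not> adj (turan_graph n l) i j \<longleftrightarrow> i mod l = j mod l" using that by (simp add: adj_turan_graph)
    also have "\<dots> \<longleftrightarrow> (if i < l then i else i - l) = (if j < l then j else j - l)"
      using m[OF that(1)] m[OF that(2)] by metis
    also have "(if i < l then i else i - l) = (if j < l then j else j - l) \<longleftrightarrow> j = i + l \<or> i = j + l"
    proof -
      have "i < 2 * l" "j < 2 * l" using that(1,2) n by linarith+
      then show ?thesis using that(3) by (cases "i < l"; cases "j < l") auto
    qed
    finally show ?thesis .
  qed
  show ?thesis
    unfolding nonadjacency_matching_def V
  proof (intro conjI ballI impI)
    fix v x y assume "v \<in> {..<n}" "x \<in> {..<n} - {v}" "y \<in> {..<n} - {v}"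
      "\<not> adj (turan_graph n l) v x \<and> \<not> adj (turan_graph n l) v y"
    then have "x = v + l \<or> v = x + l" "y = v + l \<or> v = y + l" and "x < n" "y < n"
      using non[of v x] non[of v y] by simp_all
    moreover have "n \<le> 2 * l" using n by linarith
    ultimately show "x = y" by linarith
  next
    fix x y assume xy: "x \<in> {..<n}" "y \<in> {..<n}"
      and all: "(\<forall>z\<in>{..<n} - {x}. adj (turan_graph n l) x z) \<and> (\<forall>z\<in>{..<n} - {y}. adj (turan_graph n l) y z)"
    have "w = l - 1" if w: "w < n" "\<forall>z\<in>{..<n} - {w}. adj (turan_graph n l) w z" for w
    proof (rule ccontr)
      assume ne: "w \<noteq> l - 1"
      define z where "z = (if w < l then w + l else w - l)"
      have "z < n" "z \<noteq> w" "z = w + l \<or> w = z + l" using ne w(1) n l by (auto simp: z_def)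
      then show False using non[of w z] w by auto
    qed
    then show "x = y" using all xy by blast
  qed
qed

lemma iso_turan_graph_iff:
  assumes G: "simple_graph G" and n: "n = 2 * l \<or> n = 2 * l - 1" and l: "1 \<le> l"
  shows "G \<simeq>\<^sub>g turan_graph n l \<longleftrightarrow> card (verts G) = n \<and> nonadjacency_matching (adj G) (verts G)"
proof
  let ?T = "turan_graph n l"
  assume "G \<simeq>\<^sub>g ?T"
  then obtain f where f: "bij_betw f (verts G) (verts ?T)"
      "\<forall>x\<in>verts G. \<forall>y\<in>verts G. adj G x y \<longleftrightarrow> adj ?T (f x) (f y)"
    unfolding graph_iso_def by blast
  have inj: "inj_on f (verts G)" and im: "f ` verts G = verts ?T" using f(1) by (simp_all add: bij_betw_def)
  note T = turan_graph_nonadjacency_matching[OF n l]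
  have "card (verts G) = n" using bij_betw_same_card[OF f(1)] by (simp add: turan_graph_def)
  moreover have "nonadjacency_matching (adj G) (verts G)"
    unfolding nonadjacency_matching_def
  proof (intro conjI ballI impI)
    fix v x y assume a: "v \<in> verts G" "x \<in> verts G - {v}" "y \<in> verts G - {v}" "\<not> adj G v x \<and> \<not> adj G v y"
    have "f x \<in> verts ?T - {f v}" "f y \<in> verts ?T - {f v}" "f v \<in> verts ?T"
      using a im inj unfolding inj_on_def by blast+
    moreover have "\<not> adj ?T (f v) (f x) \<and> \<not> adj ?T (f v) (f y)" using a f(2) by blast
    ultimately have "f x = f y" using T unfolding nonadjacency_matching_def by blast
    then show "x = y" using inj a unfolding inj_on_def by blast
  next
    fix x y assume a: "x \<in> verts G" "y \<in> verts G"
      "(\<forall>z\<in>verts G - {x}. adj G x z) \<and> (\<forall>z\<in>verts G - {y}. adj G y z)"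
    have univ: "\<forall>z\<in>verts ?T - {f w}. adj ?T (f w) z" if "w \<in> verts G" "\<forall>z\<in>verts G - {w}. adj G w z" for w
    proof
      fix z assume "z \<in> verts ?T - {f w}"
      then obtain z' where "z' \<in> verts G - {w}" "z = f z'" unfolding im[symmetric] by blast
      then show "adj ?T (f w) z" using that f(2) by blast
    qed
    have "f x \<in> verts ?T" "f y \<in> verts ?T" using a im by blast+
    then have "f x = f y"
      using T univ[OF a(1)] univ[OF a(2)] a(3) unfolding nonadjacency_matching_def by blast
    then show "x = y" using inj a unfolding inj_on_def by blast
  qed
  ultimately show "card (verts G) = n \<and> nonadjacency_matching (adj G) (verts G)" ..
next
  let ?T = "turan_graph n l"
  assume a: "card (verts G) = n \<and> nonadjacency_matching (adj G) (verts G)"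
  have c: "card (verts G) = card (verts ?T)" using a by (simp add: turan_graph_def)
  have fin: "finite (verts G)" "finite (verts ?T)" using G by (simp_all add: simple_graph_def turan_graph_def)
  have i: "\<not> adj G x x" "\<not> adj ?T i i" for x i
    using adj_vertsD(3)[OF G, of x x] adj_turan_graph[of i i n l] by blast+
  have "\<exists>f. bij_betw f (verts G) (verts ?T) \<and> (\<forall>x\<in>verts G. \<forall>y\<in>verts G. adj G x y \<longleftrightarrow> adj ?T (f x) (f y))"
    by (rule nonadjacency_matching_iso[OF fin c _ turan_graph_nonadjacency_matching[OF n l]])
      (use a i in \<open>auto simp: insert_commute\<close>)
  then show "G \<simeq>\<^sub>g ?T" unfolding graph_iso_def by blast
qed

section \<open>The listed graphs are minimally tough\<close>

lemma toughness_less: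
  assumes G: "simple_graph G" and c: "0 \<le> c" and X: "X \<subseteq> verts G"
    and f: "\<And>u v. u \<in> X \<Longrightarrow> v \<in> X \<Longrightarrow> adj G u v \<Longrightarrow> f u = f v"
    and k: "k \<le> card (f ` X)" "2 \<le> k" and less: "real (card (verts G)) - real (card X) < c * real k"
  shows "toughness G < ereal c"
proof (rule ccontr)
  assume "\<not> toughness G < ereal c"
  then have "ereal c \<le> toughness G" by simp
  from toughness_bound[OF G this c X f k] less show False by simp
qed

lemma toughness_ge:
  assumes "finite (verts G)"
    and "\<And>S. separator G S \<Longrightarrow> c * real (num_components (delete_verts G S)) \<le> real (card S)"
  shows "ereal c \<le> toughness G"
proof (cases "\<exists>S. separator G S")
  case True
  then obtain S where S: "separator G S"
    "toughness G = ereal (real (card S) / real (num_components (delete_verts G S)))"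
    using toughness_eq_separator[OF assms(1)] by metis
  have "real (num_components (delete_verts G S)) > 0" using S(1) by (simp add: separator_def)
  then show ?thesis using assms(2)[OF S(1)] S(2) by (simp add: le_divide_eq)
next
  case False
  then show ?thesis by (simp add: toughness_def)
qed

lemma separator_complement_of_pair:
  assumes "simple_graph G" "x \<in> verts G" "y \<in> verts G" "x \<noteq> y" "\<not> adj G x y"
  shows "separator G (verts G - {x, y})"
proof -
  let ?D = "delete_verts G (verts G - {x, y})"
  have V: "verts ?D = {x, y}" using assms by auto
  have "card ((\<lambda>z. z) ` verts ?D) \<le> num_components ?D"
  proof (rule num_components_ge_card_labels)
    fix u v assume "adj ?D u v"
    then have "adj G u v" "u \<in> {x, y}" "v \<in> {x, y}"
      using adj_vertsD[OF assms(1), of u v] unfolding adj_delete_verts[OF assms(1)] by auto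
    then show "u = v" using assms(5) by (auto simp: insert_commute)
  next
    show "finite (verts ?D)" unfolding V by simp
  qed
  then show ?thesis using assms(4) V by (simp add: separator_def)
qed

text \<open>The number \<open>c\<close> only has to separate the toughness of \<open>G\<close> from that of every \<open>G - e\<close>; for double stars
  this avoids computing the toughness.\<close>

lemma nontrivially_minimally_toughI:
  assumes G: "simple_graph G" and x: "x \<in> verts G" "y \<in> verts G" "x \<noteq> y" "\<not> adj G x y" and "adj G p q"
    and c: "\<And>S. separator G S \<Longrightarrow> c * real (num_components (delete_verts G S)) \<le> real (card S)"
    and less: "\<And>u v. adj G u v \<Longrightarrow> toughness (delete_edge G {u, v}) < ereal c"
  shows "nontrivially_minimally_tough G"
proof -
  have "finite (verts G)" using G by (simp add: simple_graph_def)
  then have ge: "ereal c \<le> toughness G" using c by (rule toughness_ge)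
  have "toughness (delete_edge G e) < toughness G" if e: "e \<in> edges G" for e
  proof -
    have "card e = 2" using e G by (simp add: simple_graph_def)
    then obtain u v where "e = {u, v}" by (meson card_2_iff)
    then show ?thesis using order_less_le_trans[OF less ge] e by blast
  qed
  moreover have "toughness G \<noteq> -\<infinity>" using ge by auto
  ultimately have "minimally_tough G" unfolding minimally_tough_def minimally_t_tough_def by blast
  moreover have "\<not> complete_graph G" using x unfolding complete_graph_def by blast
  moreover have "\<not> edgeless G" using \<open>adj G p q\<close> unfolding edgeless_def by blast
  ultimately show ?thesis by (simp add: nontrivially_minimally_tough_def)
qed

lemma adj_delete_edge: "adj (delete_edge G e) x y \<longleftrightarrow> adj G x y \<and> {x, y} \<noteq> e"
  by (auto simp: delete_edge_def)

text \<open>\<open>G\<close> is connected and every edge is a bridge: deleting an edge brings the toughness down to 0, whereas a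
  non-empty separator of \<open>G\<close> has ratio at least \<open>1 / n\<close>.\<close>

lemma double_star_minimally_tough:
  assumes G: "simple_graph G" and ds: "double_star_at G u v A B" and V: "verts G = insert u (insert v (A \<union> B))"
    and ne: "A \<noteq> {}"
  shows "nontrivially_minimally_tough G"
proof -
  note d = double_star_at_distinct[OF G ds]
  note adjG = adj_double_star_at[OF G ds, folded V]
  have fin: "finite (verts G)" using G by (simp add: simple_graph_def)
  have uv: "u \<in> verts G" "v \<in> verts G" "adj G u v" using V ds by (auto simp: double_star_at_def)
  obtain a where a: "a \<in> A" using ne by blast
  have n0: "0 < card (verts G)" using uv fin card_gt_0_iff by blast
  show ?thesis
  proof (rule nontrivially_minimally_toughI[OF G _ _ _ _ uv(3), of a v "1 / real (card (verts G))"])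
    show "a \<in> verts G" "v \<in> verts G" "a \<noteq> v" using a d uv by auto
    show "\<not> adj G a v" using adjG[of a v] a d uv by auto
  next
    fix S assume S: "separator G S"
    have "S \<noteq> {}"
    proof
      assume "S = {}"
      let ?D = "delete_verts G {}"
      have r: "(x, y) \<in> reachable ?D" if "adj G x y" for x y
        using reachable_adj[of x y ?D] that adj_vertsD[OF G that] adj_delete_verts[OF G, of x y "{}"] by auto
      have "num_components ?D \<le> card {u}"
      proof (rule num_components_le_card_cover)
        fix w assume "w \<in> verts ?D"
        then consider "w = u" | "adj G u w" | "w \<in> B" using V adjG[of u w] uv by auto
        then have "(u, w) \<in> reachable ?D"
        proof cases
          case 1 then show ?thesis using reachable_refl[of u ?D] uv by simp
        next
          case 2 then show ?thesis by (rule r)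
        next
          case 3
          then have "adj G v w" using ds by (simp add: double_star_at_def)
          then show ?thesis using reachable_trans[OF r[OF uv(3)] r] by blast
        qed
        then show "\<exists>x\<in>{u}. (x, w) \<in> reachable ?D" by simp
      qed simp
      then show False using S \<open>S = {}\<close> by (simp add: separator_def)
    qed
    have SV: "S \<subseteq> verts G" using S by (simp add: separator_def)
    then have "1 \<le> card S" using \<open>S \<noteq> {}\<close> fin finite_subset by (simp add: Suc_le_eq card_gt_0_iff)
    moreover have "num_components (delete_verts G S) \<le> card (verts G)"
    proof -
      have "num_components (delete_verts G S) \<le> card (verts G - S)"
        using num_components_le_card_verts[of "delete_verts G S"] fin by simp
      also have "\<dots> \<le> card (verts G)" using fin by (simp add: card_mono)
      finally show ?thesis .
    qed
    then have "1 / real (card (verts G)) * real (num_components (delete_verts G S)) \<le> 1"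
      using n0 by (simp add: divide_le_eq)
    ultimately show "1 / real (card (verts G)) * real (num_components (delete_verts G S)) \<le> real (card S)"
      by linarith
  next
    fix x y assume xy: "adj G x y"
    let ?H = "delete_edge G {x, y}"
    have bridge: "toughness ?H < ereal (1 / real (card (verts G)))"
      if f: "\<And>p q. adj G p q \<Longrightarrow> {p, q} \<noteq> {x, y} \<Longrightarrow> f p = f q" and xy': "f x \<noteq> f y" for f :: "'a \<Rightarrow> bool"
    proof (rule toughness_less[OF simple_delete_edge[OF G], of _ "verts G" _ f 2])
      show "f p = f q" if "adj ?H p q" for p q using f[of p q] that by (simp add: adj_delete_edge)
      have "{f x, f y} \<subseteq> f ` verts G" using adj_vertsD[OF G xy] by blast
      then have "card {f x, f y} \<le> card (f ` verts G)" using fin by (intro card_mono) auto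
      then show "2 \<le> card (f ` verts G)" using xy' by simp
    qed (use n0 in auto)
    have xyV: "x \<in> verts G" "y \<in> verts G" "x \<noteq> y" using adj_vertsD[OF G xy] by auto
    have leaf: "q = (if l \<in> A then u else v)" if "l \<in> A \<union> B" "adj G l q" for l q
      using adjG[of l q] adj_vertsD[OF G that(2)] that d by auto
    have "{x, y} = {u, v} \<or> x \<in> A \<union> B \<or> y \<in> A \<union> B"
      using xyV unfolding V by auto
    then consider "{x, y} = {u, v}" | "x \<in> A \<union> B" | "y \<in> A \<union> B" by blast
    then show "toughness ?H < ereal (1 / real (card (verts G)))"
    proof cases
      case 1
      show ?thesis
      proof (rule bridge[of "\<lambda>p. p \<in> insert u A"])
        fix p q assume pq: "adj G p q" "{p, q} \<noteq> {x, y}"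
        then have "(p = u \<and> q \<in> A) \<or> (p \<in> A \<and> q = u) \<or> (p = v \<and> q \<in> B) \<or> (p \<in> B \<and> q = v)"
          using adjG[of p q] adj_vertsD[OF G pq(1)] unfolding 1 by (auto simp: insert_commute)
        then show "(p \<in> insert u A) = (q \<in> insert u A)" using d by blast
      next
        show "(x \<in> insert u A) \<noteq> (y \<in> insert u A)" using 1 d by (auto simp: doubleton_eq_iff)
      qed
    next
      case 2
      show ?thesis
      proof (rule bridge[of "\<lambda>p. p = x"])
        fix p q assume pq: "adj G p q" "{p, q} \<noteq> {x, y}"
        show "(p = x) = (q = x)"
        proof (rule ccontr)
          assume "(p = x) \<noteq> (q = x)"
          then have "adj G x p \<and> q = x \<or> adj G x q \<and> p = x" using pq(1) by (auto simp: insert_commute)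
          then show False using leaf[OF 2 xy] leaf[OF 2, of p] leaf[OF 2, of q] pq(2) by (auto simp: insert_commute)
        qed
      qed (use xyV in simp)
    next
      case 3
      have yx: "adj G y x" using xy by (simp add: insert_commute)
      show ?thesis
      proof (rule bridge[of "\<lambda>p. p = y"])
        fix p q assume pq: "adj G p q" "{p, q} \<noteq> {x, y}"
        show "(p = y) = (q = y)"
        proof (rule ccontr)
          assume "(p = y) \<noteq> (q = y)"
          then have "adj G y p \<and> q = y \<or> adj G y q \<and> p = y" using pq(1) by (auto simp: insert_commute)
          then show False using leaf[OF 3 yx] leaf[OF 3, of p] leaf[OF 3, of q] pq(2) by (auto simp: insert_commute)
        qed
      qed (use xyV in simp)
    qed
  qed
qed

text \<open>The toughness is \<open>2/3\<close>: a separator contains one of the two parts. When an edge at \<open>q \<in> B\<close> is deleted,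
  the other vertex of \<open>A\<close> becomes a cut vertex, and the ratio drops to \<open>1/2\<close>.\<close>

lemma bipartition_2_3_minimally_tough:
  assumes G: "simple_graph G" and AB: "bipartition G A B" "card A = 2" "card B = 3"
  shows "nontrivially_minimally_tough G"
proof -
  have V: "verts G = A \<union> B" and disj: "A \<inter> B = {}"
    and adjG: "\<And>x y. x \<in> verts G \<Longrightarrow> y \<in> verts G \<Longrightarrow> adj G x y \<longleftrightarrow> (x \<in> A \<and> y \<in> B) \<or> (x \<in> B \<and> y \<in> A)"
    using AB(1) unfolding bipartition_def by auto
  have fin: "finite A" "finite B" using AB(2,3) card_ge_0_finite by force+
  have n: "card (verts G) = 5" using V disj fin AB by (simp add: card_Un_disjoint)
  obtain a a' where A: "A = {a, a'}" "a \<noteq> a'" using AB(2) by (meson card_2_iff)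
  obtain b where b: "b \<in> B" using AB(3) by fastforce
  show ?thesis
  proof (rule nontrivially_minimally_toughI[OF G, of a a' a b "2 / 3"])
    show "a \<in> verts G" "a' \<in> verts G" "a \<noteq> a'" using A V by auto
    show "\<not> adj G a a'" using adjG[of a a'] A V disj by auto
    show "adj G a b" using adjG[of a b] A V b by auto
  next
    fix S assume S: "separator G S"
    have SV: "S \<subseteq> verts G" using S by (simp add: separator_def)
    let ?D = "delete_verts G S"
    have finS: "finite S" using SV fin V finite_subset by (metis finite_UnI)
    have two: "2 \<le> num_components ?D" using S by (simp add: separator_def)
    have "A \<subseteq> S \<or> B \<subseteq> S"
    proof (rule ccontr)
      assume "\<not> (A \<subseteq> S \<or> B \<subseteq> S)"
      then obtain p q where p: "p \<in> A" "p \<notin> S" and q: "q \<in> B" "q \<notin> S" by blast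
      have r: "(x, y) \<in> reachable ?D" if "x \<in> A - S" "y \<in> B - S \<or> y \<in> B - S" for x y
        using reachable_adj[of x y ?D] adj_delete_verts[OF G, of x y S] adjG[of x y] V that by auto
      have r': "(y, x) \<in> reachable ?D" if "x \<in> A - S" "y \<in> B - S" for x y
        using reachable_adj[of y x ?D] adj_delete_verts[OF G, of y x S] adjG[of y x] V that by auto
      have "num_components ?D \<le> card {p}"
      proof (rule num_components_le_card_cover)
        fix w assume "w \<in> verts ?D"
        then have "w \<in> A - S \<or> w \<in> B - S" using V by auto
        then have "(p, w) \<in> reachable ?D"
          using r[of p w] reachable_trans[of p q ?D w] r[of p q] r'[of w q] p q by blast
        then show "\<exists>x\<in>{p}. (x, w) \<in> reachable ?D" by simp
      qed simp
      then show False using two by simp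
    qed
    then have cS: "2 \<le> card S" using card_mono[OF finS, of A] card_mono[OF finS, of B] AB by auto
    have "num_components ?D \<le> card (verts G - S)"
      using num_components_le_card_verts[of ?D] fin V by simp
    also have "\<dots> = 5 - card S" using card_Diff_subset[OF finS SV] n by simp
    finally have "num_components ?D \<le> 3" using cS by simp
    then show "2 / 3 * real (num_components ?D) \<le> real (card S)" using cS by simp
  next
    fix x y assume xy: "adj G x y"
    have less: "toughness (delete_edge G {x, y}) < ereal (2 / 3)" if p: "p \<in> A" "q \<in> B" "{x, y} = {p, q}" for p q
    proof -
      obtain p' where p': "A = {p, p'}" "p \<noteq> p'" using A p(1) by auto
      have "p \<noteq> q" "p' \<noteq> q" using p p' disj by auto
      let ?X = "verts G - {p'}"
      have pX: "p \<in> ?X" "q \<in> ?X" "p' \<in> verts G" using p p' V disj by auto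
      show ?thesis
      proof (rule toughness_less[OF simple_delete_edge[OF G], of _ ?X _ "\<lambda>w. w = q" 2])
        fix u w assume uw: "u \<in> ?X" "w \<in> ?X" "adj (delete_edge G {x, y}) u w"
        then have "adj G u w" "{u, w} \<noteq> {p, q}" using p(3) by (auto simp: adj_delete_edge)
        then have "u = p \<and> w \<in> B - {q} \<or> u \<in> B - {q} \<and> w = p"
          using adjG[of u w] uw p' by (auto simp: insert_commute)
        then show "(u = q) = (w = q)" using \<open>p \<noteq> q\<close> by blast
      next
        have "(\<lambda>w. w = q) ` ?X = {True, False}" using pX \<open>p \<noteq> q\<close> by auto
        then show "2 \<le> card ((\<lambda>w. w = q) ` ?X)" by simp
        have "card ?X = 4" using n pX fin V by simp
        then show "real (card (verts (delete_edge G {x, y}))) - real (card ?X) < 2 / 3 * real 2" using n by simp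
      qed auto
    qed
    have "x \<in> A \<and> y \<in> B \<or> x \<in> B \<and> y \<in> A" using adjG[of x y] xy adj_vertsD[OF G xy] by blast
    then show "toughness (delete_edge G {x, y}) < ereal (2 / 3)"
      using less[of x y] less[of y x] by (auto simp: insert_commute)
  qed
qed

text \<open>Among three remaining vertices any two are adjacent or have a common neighbour, so a separator leaves just
  a non-adjacent pair, and the toughness is \<open>(n - 2) / 2\<close>. An edge \<open>uv\<close> has an end, say \<open>u\<close>, with a non-neighbour
  \<open>u'\<close>; after deleting \<open>uv\<close> one may keep \<open>u, u', v\<close> with \<open>u\<close> isolated, which gives the ratio \<open>(n - 3) / 2\<close>.\<close>

lemma nonadjacency_matching_minimally_tough:
  assumes G: "simple_graph G" and M: "nonadjacency_matching (adj G) (verts G)" and n3: "3 \<le> card (verts G)"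
  shows "nontrivially_minimally_tough G"
proof -
  let ?n = "card (verts G)"
  have fin: "finite (verts G)" using G by (simp add: simple_graph_def)
  have uniq: "\<And>v x y. v \<in> verts G \<Longrightarrow> x \<in> verts G - {v} \<Longrightarrow> y \<in> verts G - {v} \<Longrightarrow> \<not> adj G v x \<Longrightarrow> \<not> adj G v y \<Longrightarrow> x = y"
    and univ: "\<And>x y. x \<in> verts G \<Longrightarrow> y \<in> verts G \<Longrightarrow> \<forall>z\<in>verts G - {x}. adj G x z \<Longrightarrow> \<forall>z\<in>verts G - {y}. adj G y z \<Longrightarrow> x = y"
    using M unfolding nonadjacency_matching_def by blast+
  have sym: "adj G x y \<longleftrightarrow> adj G y x" for x y by (simp add: insert_commute)
  obtain x y where xy: "x \<in> verts G" "y \<in> verts G" "x \<noteq> y" "\<not> adj G x y"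
    using nonadjacency_matching_pair[OF M] n3 by auto
  have "\<not> verts G \<subseteq> {x, y}" using card_mono[of "{x, y}" "verts G"] n3 xy(3) by auto
  then obtain z where z: "z \<in> verts G" "z \<noteq> x" "z \<noteq> y" by blast
  show ?thesis
  proof (rule nontrivially_minimally_toughI[OF G xy, of x z "(real ?n - 2) / 2"])
    show "adj G x z" using uniq[of x y z] xy z by blast
  next
    fix S assume S: "separator G S"
    have SV: "S \<subseteq> verts G" using S by (simp add: separator_def)
    let ?D = "delete_verts G S"
    have two: "2 \<le> num_components ?D" using S by (simp add: separator_def)
    have card: "card (verts G - S) \<le> 2"
    proof (rule ccontr)
      assume "\<not> card (verts G - S) \<le> 2"
      then have c3: "3 \<le> card (verts G - S)" by simp
      then have "verts G - S \<noteq> {}" by (metis card.empty not_numeral_le_zero)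
      then obtain p where p: "p \<in> verts G - S" by blast
      have r: "(q, w) \<in> reachable ?D" if "q \<in> verts G - S" "w \<in> verts G - S" "adj G q w" for q w
        using reachable_adj[of q w ?D] adj_delete_verts[OF G, of q w S] that by auto
      have "num_components ?D \<le> card {p}"
      proof (rule num_components_le_card_cover)
        fix w assume "w \<in> verts ?D"
        then have w: "w \<in> verts G - S" by simp
        have "(p, w) \<in> reachable ?D"
        proof (cases "w = p \<or> adj G p w")
          case True
          then show ?thesis using r[OF p w] reachable_refl[of p ?D] p by auto
        next
          case False
          have "\<not> verts G - S \<subseteq> {p, w}" using card_mono[of "{p, w}" "verts G - S"] c3 False by auto
          then obtain q where q: "q \<in> verts G - S" "q \<noteq> p" "q \<noteq> w" by blast
          have "adj G p q" using uniq[of p w q] p q w False by blast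
          moreover have "adj G q w" using uniq[of w p q] p q w False sym[of w p] sym[of w q] by blast
          ultimately show ?thesis using r[OF p q(1)] r[OF q(1) w] reachable_trans[of p q ?D w] by blast
        qed
        then show "\<exists>x\<in>{p}. (x, w) \<in> reachable ?D" by simp
      qed simp
      then show False using two by simp
    qed
    have "num_components ?D \<le> card (verts G - S)"
      using num_components_le_card_verts[of ?D] fin by simp
    then have "num_components ?D \<le> 2" using card by simp
    moreover have "card (verts G - S) = ?n - card S" using card_Diff_subset[OF finite_subset[OF SV fin] SV] .
    ultimately have "real (num_components ?D) = 2" "real ?n - 2 \<le> real (card S)" using two card by auto
    then show "(real ?n - 2) / 2 * real (num_components ?D) \<le> real (card S)" by simp
  next
    fix p q assume pq: "adj G p q"
    have less: "toughness (delete_edge G {p, q}) < ereal ((real ?n - 2) / 2)"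
      if u: "{p, q} = {u, v}" "u \<in> verts G" "v \<in> verts G" "u \<noteq> v" and u': "u' \<in> verts G" "u' \<noteq> u" "\<not> adj G u u'" for u v u'
    proof -
      have "adj G u v" using pq u(1) by simp
      then have "u' \<noteq> v" using u' by blast
      let ?X = "{u, u', v}"
      have c: "card ?X = 3" using u u' \<open>u' \<noteq> v\<close> by simp
      show ?thesis
      proof (rule toughness_less[OF simple_delete_edge[OF G], of _ ?X _ "\<lambda>w. w = u" 2])
        fix x y assume "x \<in> ?X" "y \<in> ?X" "adj (delete_edge G {p, q}) x y"
        then have "x \<in> ?X" "y \<in> ?X" "adj G x y" "{x, y} \<noteq> {u, v}" using u(1) by (auto simp: adj_delete_edge)
        then show "(x = u) = (y = u)" using u'(3) sym by blast
      next
        have "(\<lambda>w. w = u) ` ?X = {True, False}" using u' by auto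
        then show "2 \<le> card ((\<lambda>w. w = u) ` ?X)" by simp
      qed (use c u u' n3 in auto)
    qed
    have V: "p \<in> verts G" "q \<in> verts G" "p \<noteq> q" using adj_vertsD[OF G pq] by auto
    consider w where "w \<in> verts G - {p}" "\<not> adj G p w" | w where "w \<in> verts G - {q}" "\<not> adj G q w"
      using univ[OF V(1,2)] V(3) by blast
    then show "toughness (delete_edge G {p, q}) < ereal ((real ?n - 2) / 2)"
    proof cases
      case 1
      then show ?thesis using less[of p q w] V by blast
    next
      case 2
      then show ?thesis using less[of q p w] V insert_commute[of p q "{}"] by blast
    qed
  qed
qed

section \<open>The classification\<close>

text \<open>By symmetry of the dominating edge one may assume that the side of \<open>u\<close> has at least as many leaves as that
  of \<open>v\<close>.\<close>

lemma nontrivially_minimally_tough_structure: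
  assumes G: "simple_graph G" and net: "net_free G" and cc: "co_chordal G"
    and nmt: "nontrivially_minimally_tough G"
  shows "(\<exists>u v A B. double_star_at G u v A B \<and> verts G = insert u (insert v (A \<union> B)) \<and> A \<noteq> {} \<and> card B \<le> card A) \<or>
    (nonadjacency_matching (adj G) (verts G) \<and> 3 \<le> card (verts G)) \<or>
    (\<exists>A B. bipartition G A B \<and> card A = 2 \<and> card B = 3)"
proof -
  let ?H = "complement G"
  have fin: "finite (verts G)" using G by (simp add: simple_graph_def)
  obtain x0 y0 where xy: "x0 \<in> verts G" "y0 \<in> verts G" "x0 \<noteq> y0" "\<not> adj G x0 y0"
    using nmt unfolding nontrivially_minimally_tough_def complete_graph_def by blast
  obtain e where e: "e \<in> edges G"
    using nmt unfolding nontrivially_minimally_tough_def edgeless_def by blast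
  have "card e = 2" using e G by (simp add: simple_graph_def)
  then obtain p q where "e = {p, q}" by (meson card_2_iff)
  then have pq: "adj G p q" using e by simp
  obtain S where "separator G S" "toughness G = ereal (real (card S) / real (num_components (delete_verts G S)))"
    using toughness_eq_separator[OF fin separator_complement_of_pair[OF G xy]] by blast
  then obtain t where t: "toughness G = ereal t" by blast
  have crit: "toughness (delete_edge G {u, v}) < ereal t" if "adj G u v" for u v
    using nmt that t unfolding nontrivially_minimally_tough_def minimally_tough_def minimally_t_tough_def by auto
  have "0 < t"
  proof -
    have "ereal 0 \<le> toughness (delete_edge G {p, q})"
      by (rule toughness_ge) (use fin in auto)
    then show ?thesis using crit[OF pq] by (metis ereal_less_eq(3) linorder_not_le order_le_less_trans ereal_less(2) zero_ereal_def)
  qed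
  moreover have "\<forall>u v. adj G u v \<longrightarrow> toughness (delete_edge G {u, v}) < ereal t" using crit by blast
  ultimately have tough: "simple_graph G" "toughness G = ereal t" "0 < t"
    "\<forall>u v. adj G u v \<longrightarrow> toughness (delete_edge G {u, v}) < ereal t"
    using G t by blast+
  note isolated_bound = isolated_bound[OF tough]
  let ?n = "real (card (verts G))"
  have sym: "adj G x y \<longleftrightarrow> adj G y x" for x y by (rule adj_sym)
  have irrefl: "\<not> adj G x x" for x using adj_vertsD(3)[OF G, of x x] by blast
  have H: "simple_graph ?H" "chordal ?H" using G cc by (simp_all add: simple_complement co_chordal_def)
  have no_isolated: "\<exists>w\<in>verts G. adj G v w" if v: "v \<in> verts G" for v
  proof (rule ccontr)
    assume n: "\<not> (\<exists>w\<in>verts G. adj G v w)"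
    obtain w where "w \<in> verts G" "v \<noteq> w" using xy by metis
    then have "2 * t \<le> ?n - real (card (verts G))"
      by (intro isolated_bound[of _ v w]) (use n v in auto)
    then show False using tough(3) by simp
  qed
  obtain u v where uv: "simplicial ?H u" "simplicial ?H v" "u \<noteq> v" "\<not> adj ?H u v"
    and far: "\<forall>w. \<not> (adj ?H u w \<and> adj ?H v w)"
  proof (rule simplicial_pair_far_apart[OF H])
    show "net_free (complement ?H)" using net complement_complement[OF G] by simp
    show "verts ?H \<noteq> {}" using xy(1) by auto
    fix v assume "v \<in> verts ?H"
    then obtain w where "w \<in> verts G" "adj G v w" using no_isolated by auto
    then show "\<exists>w\<in>verts ?H. w \<noteq> v \<and> \<not> adj ?H v w"
      using irrefl[of v] unfolding verts_complement adj_complement by (metis)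
  qed
  have uvV: "u \<in> verts G" "v \<in> verts G" using uv(1,2) by (simp_all add: simplicial_in_def)
  have edge: "adj G u v" using uv(3,4) uvV unfolding adj_complement by blast
  have dom: "adj G u w \<or> adj G v w" if "w \<in> verts G" "w \<noteq> u" "w \<noteq> v" for w
    using far that uvV unfolding adj_complement by blast
  obtain A B where AB: "double_star_at G u v A B" "?n - (2 + real (card A) + real (card B)) < 2 * t"
    using dominating_edge_double_star[OF tough edge uv(1,2) dom] by blast
  have main: ?thesis
    if s: "double_star_at G u v A B" "card B \<le> card A" "simplicial ?H u" "simplicial ?H v"
      "\<And>w. w \<in> verts G \<Longrightarrow> w \<noteq> u \<Longrightarrow> w \<noteq> v \<Longrightarrow> adj G u w \<or> adj G v w"
      "?n - (2 + real (card A) + real (card B)) < 2 * t" for u v A B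
  proof -
    have "verts G = insert u (insert v (A \<union> B)) \<and> A \<noteq> {} \<or> ?n - 3 < 2 * t \<or>
      (\<exists>z. verts G = insert z (insert u (insert v A)) \<and> card A = 2 \<and> z \<notin> A \<and> z \<noteq> u \<and> z \<noteq> v \<and>
        adj G v z \<and> \<not> adj G u z \<and> (\<forall>a\<in>A. adj G z a) \<and> B = {})"
      by (rule bigger_side_classification[OF tough s(1,2,3,4) H(2) _ s(6) xy]) (use s(5) in blast)
    then show ?thesis
    proof (elim disjE)
      assume "verts G = insert u (insert v (A \<union> B)) \<and> A \<noteq> {}"
      then show ?thesis using s(1,2) by blast
    next
      assume small: "?n - 3 < 2 * t"
      have "nonadjacency_matching (adj G) (verts G)"
        by (rule nonadjacency_matching_if_tough[OF tough xy small])
      moreover have "3 \<le> card (verts G)"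
      proof -
        obtain w where w: "w \<in> verts G" "adj G x0 w" using no_isolated xy(1) by blast
        then have "w \<noteq> x0" "w \<noteq> y0" using irrefl xy by blast+
        then have "card {x0, y0, w} = 3" using xy(3) by simp
        then show ?thesis using card_mono[OF fin, of "{x0, y0, w}"] xy w by simp
      qed
      ultimately show ?thesis by blast
    next
      assume "\<exists>z. verts G = insert z (insert u (insert v A)) \<and> card A = 2 \<and> z \<notin> A \<and> z \<noteq> u \<and> z \<noteq> v \<and>
          adj G v z \<and> \<not> adj G u z \<and> (\<forall>a\<in>A. adj G z a) \<and> B = {}"
      then obtain z where z: "verts G = insert z (insert u (insert v A))" "card A = 2" "z \<notin> A" "z \<noteq> u" "z \<noteq> v"
          "adj G v z" "\<not> adj G u z" "\<forall>a\<in>A. adj G z a" by blast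
      note d = double_star_at_distinct[OF G s(1)]
      have ds: "adj G u v" "\<forall>a\<in>A. adj G u a \<and> \<not> adj G v a" "\<forall>x\<in>A. \<forall>y\<in>A. \<not> adj G x y"
        using s(1) unfolding double_star_at_def by blast+
      have finA: "finite A" using z(2) card_ge_0_finite by force
      have "bipartition G {u, z} (insert v A)"
        unfolding bipartition_def
      proof (intro conjI ballI)
        show "verts G = {u, z} \<union> insert v A" using z(1) by blast
        show "{u, z} \<inter> insert v A = {}" using z d by blast
        fix x y assume xy: "x \<in> verts G" "y \<in> verts G"
        have across: "adj G p q" if "p \<in> {u, z}" "q \<in> insert v A" for p q
          using that ds z(6,8) sym[of z v] by blast
        have inside: "\<not> adj G p q" if "p \<in> {u, z} \<and> q \<in> {u, z} \<or> p \<in> insert v A \<and> q \<in> insert v A" for p q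
          using that ds z(7) sym[of z u] sym[of p v] irrefl by blast
        have "x \<in> {u, z} \<or> x \<in> insert v A" "y \<in> {u, z} \<or> y \<in> insert v A" using xy z(1) by blast+
        then show "adj G x y \<longleftrightarrow> (x \<in> {u, z} \<and> y \<in> insert v A) \<or> (x \<in> insert v A \<and> y \<in> {u, z})"
          using across[of x y] across[of y x] inside[of x y] sym[of x y] by blast
      qed
      moreover have "card {u, z} = 2" "card (insert v A) = 3" using z d finA by simp_all
      ultimately show ?thesis by blast
    qed
  qed
  show ?thesis
  proof (cases "card B \<le> card A")
    case True
    show ?thesis by (rule main[OF AB(1) True uv(1,2) _ AB(2)]) (use dom in blast)
  next
    case False
    show ?thesis
    proof (rule main[OF double_star_at_swap[OF AB(1)] _ uv(2,1)])
      show "card A \<le> card B" using False by simp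
      show "?n - (2 + real (card B) + real (card A)) < 2 * t" using AB(2) by simp
      show "adj G v w \<or> adj G u w" if "w \<in> verts G" "w \<noteq> v" "w \<noteq> u" for w using dom that by blast
    qed
  qed
qed

theorem theorem1p4:
  fixes G :: "'a ugraph"
  assumes "simple_graph G" and "net_free G" and "co_chordal G"
  shows "nontrivially_minimally_tough G \<longleftrightarrow>
    (\<exists>k l :: nat. k \<ge> 1 \<and> l \<ge> 2 \<and>
      (G \<simeq>\<^sub>g path_graph 4 \<or>
       G \<simeq>\<^sub>g complete_bipartite 2 3 \<or>
       G \<simeq>\<^sub>g complete_bipartite 1 l \<or>
       G \<simeq>\<^sub>g double_star k l \<or>
       G \<simeq>\<^sub>g turan_graph (2 * l) l \<or>
       G \<simeq>\<^sub>g turan_graph (2 * l - 1) l))"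
    (is "_ \<longleftrightarrow> ?listed")
proof -
  note G = assms(1)
  have fin: "finite (verts G)" using G by (simp add: simple_graph_def)
  let ?DS = "\<lambda>k l. \<exists>u v A B. double_star_at G u v A B \<and> verts G = insert u (insert v (A \<union> B)) \<and>
     card A = k \<and> card B = l"
  have P4: "G \<simeq>\<^sub>g path_graph 4 \<longleftrightarrow> ?DS 1 1"
    using double_star_at_transfer[OF G simple_path_graph path_graph_4_double_star] by simp
  have star: "G \<simeq>\<^sub>g star l \<longleftrightarrow> ?DS (l - 1) 0" if "l \<ge> 1" for l
    using double_star_at_transfer[OF G simple_complete_bipartite star_double_star[OF that]]
    by (simp add: card_image)
  have dstar: "G \<simeq>\<^sub>g double_star k l \<longleftrightarrow> ?DS k l" for k l
    using double_star_at_transfer[OF G double_star_double_star[of k l]]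
    by (simp add: card_image)
  have K23: "G \<simeq>\<^sub>g complete_bipartite 2 3 \<longleftrightarrow> (\<exists>A B. bipartition G A B \<and> card A = 2 \<and> card B = 3)"
    by (rule iso_complete_bipartite_iff[OF fin])
  have turan: "G \<simeq>\<^sub>g turan_graph n l \<longleftrightarrow> card (verts G) = n \<and> nonadjacency_matching (adj G) (verts G)"
    if "n = 2 * l \<or> n = 2 * l - 1" "l \<ge> 2" for n l
    using iso_turan_graph_iff[OF G that(1)] that(2) by simp
  show ?thesis
  proof
    assume "nontrivially_minimally_tough G"
    from nontrivially_minimally_tough_structure[OF assms this] show ?listed
    proof (elim disjE)
      assume "\<exists>u v A B. double_star_at G u v A B \<and> verts G = insert u (insert v (A \<union> B)) \<and> A \<noteq> {} \<and> card B \<le> card A"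
      then obtain u v A B where ds: "double_star_at G u v A B" "verts G = insert u (insert v (A \<union> B))"
        and A: "A \<noteq> {}" "card B \<le> card A" by blast
      have "finite A" using ds(2) fin by (metis finite_Un finite_insert)
      then have c1: "card A \<ge> 1" using A(1) by (simp add: Suc_le_eq card_gt_0_iff)
      have "verts G = insert v (insert u (B \<union> A))" unfolding ds(2) by blast
      then have sw: "?DS (card B) (card A)" using double_star_at_swap[OF ds(1)] by blast
      consider "card B = 0" | "card B = 1" "card A = 1" | "card B \<ge> 1" "card A \<ge> 2"
        using c1 A(2) by linarith
      then show ?listed
      proof cases
        case 1
        then have "?DS (card A + 1 - 1) 0" using ds by auto
        then have "G \<simeq>\<^sub>g star (card A + 1)" using star[of "card A + 1"] by simp
        then show ?thesis using c1 by (intro exI[of _ 1] exI[of _ "card A + 1"]) simp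
      next
        case 2
        then have "G \<simeq>\<^sub>g path_graph 4" using P4 ds by blast
        then show ?thesis by auto
      next
        case 3
        have "G \<simeq>\<^sub>g double_star (card B) (card A)" using dstar sw by blast
        then show ?thesis using 3 by blast
      qed
    next
      assume M: "nonadjacency_matching (adj G) (verts G) \<and> 3 \<le> card (verts G)"
      define l where "l = (card (verts G) + 1) div 2"
      have l: "l \<ge> 2" "card (verts G) = 2 * l \<or> card (verts G) = 2 * l - 1"
        using M by (auto simp: l_def)
      have "G \<simeq>\<^sub>g turan_graph (2 * l) l \<or> G \<simeq>\<^sub>g turan_graph (2 * l - 1) l"
        using turan[of "2 * l" l] turan[of "2 * l - 1" l] l M by auto
      then show ?listed using l(1) by (intro exI[of _ 1] exI[of _ l]) auto
    next
      assume "\<exists>A B. bipartition G A B \<and> card A = 2 \<and> card B = 3"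
      then have "G \<simeq>\<^sub>g complete_bipartite 2 3" using K23 by simp
      then show ?listed by (intro exI[of _ 1] exI[of _ 2]) simp
    qed
  next
    assume ?listed
    then obtain k l :: nat where kl: "k \<ge> 1" "l \<ge> 2" and
      "G \<simeq>\<^sub>g path_graph 4 \<or> G \<simeq>\<^sub>g complete_bipartite 2 3 \<or> G \<simeq>\<^sub>g star l \<or> G \<simeq>\<^sub>g double_star k l \<or>
       G \<simeq>\<^sub>g turan_graph (2 * l) l \<or> G \<simeq>\<^sub>g turan_graph (2 * l - 1) l" by blast
    then have cases: "?DS 1 1 \<or> ?DS (l - 1) 0 \<or> ?DS k l \<or> (\<exists>A B. bipartition G A B \<and> card A = 2 \<and> card B = 3) \<or>
        (nonadjacency_matching (adj G) (verts G) \<and> (card (verts G) = 2 * l \<or> card (verts G) = 2 * l - 1))"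
      using P4 star[of l] dstar[of k l] K23 turan[of "2 * l" l] turan[of "2 * l - 1" l] by auto
    have DS: "nontrivially_minimally_tough G" if k': "?DS k' l'" "k' \<ge> 1" for k' l'
    proof -
      obtain u v A B where "double_star_at G u v A B" "verts G = insert u (insert v (A \<union> B))" "card A = k'"
        using k'(1) by blast
      moreover from this have "A \<noteq> {}" using k'(2) by auto
      ultimately show ?thesis using double_star_minimally_tough[OF G] by blast
    qed
    from cases show "nontrivially_minimally_tough G"
    proof (elim disjE)
      assume "?DS 1 1" then show ?thesis by (rule DS) simp
    next
      assume "?DS (l - 1) 0" then show ?thesis by (rule DS) (use kl in simp)
    next
      assume "?DS k l" then show ?thesis by (rule DS) (use kl in simp)
    next
      assume "\<exists>A B. bipartition G A B \<and> card A = 2 \<and> card B = 3"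
      then show ?thesis using bipartition_2_3_minimally_tough[OF G] by blast
    next
      assume "nonadjacency_matching (adj G) (verts G) \<and> (card (verts G) = 2 * l \<or> card (verts G) = 2 * l - 1)"
      then show ?thesis using nonadjacency_matching_minimally_tough[OF G] kl by auto
    qed
  qed
qed

end
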